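(* For any group $G$, the following are equivalent: (1) the coset nerve $\mathcal{NC}_{\mathrm{nor,fi}}(G)$ is contractible; (2) the set $\mathcal{H}_{\mathrm{nor,fi}}(G)$ of proper normal subgroups of finite index in $G$, ordered by inclusion, has infinitely many maximal elements; (3) any proper finite index subgroup $H\le G$ has infinitely many complements that are normal subgroups of finite index in $G$; (4) each proper normal subgroup of finite index in $G$ has a complement that is a normal subgroup of finite index in $G$.
   Context: For a set $\mathcal{K}$ of subgroups of a group $G$, let $\mathrm{Cosets}(\mathcal{K})=\{gH : g\in G, H\in\mathcal{K}\}$. The coset nerve $\mathcal{NC}(\mathcal{K})$ is the (geometric realization of the) abstract simplicial complex with vertex set $\mathrm{Cosets}(\mathcal{K})$ in which a finite nonempty set of cosets is a simplex if and only if the intersection of these cosets is nonempty. $\mathcal{H}_{\mathrm{nor,fi}}(G)$ denotes the set of all proper normal subgroups of finite index in $G$, and $\mathcal{NC}_{\mathrm{nor,fi}}(G):=\mathcal{NC}(\mathcal{H}_{\mathrm{nor,fi}}(G))$. A complement of a subgroup $H\le G$ is a proper subgroup $M<G$ with $G=HM$ (no condition on $H\cap M$ is imposed).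
   Formalization: If G has no proper normal subgroup of finite index (e.g. the trivial group), (3) and (4) hold vacuously while (1) and (2) fail; so the implication from (4) to (2) is stated only when such a subgroup exists, while (1)⇔(2), (2)⇒(3), (3)⇔(4) are stated for every group. *)

theory Defs
  imports "HOL-Algebra.Left_Coset" "HOL-Analysis.Analysis"
begin

section \<open>Geometric realization of an abstract simplicial complex\<close>

text \<open>
  An abstract simplicial complex is given by the set \<open>K\<close> of its simplices (finite nonempty
  sets of vertices, closed under nonempty subsets). Points of the realization are
  barycentric coordinate functions on the vertices.
\<close>

definition closed_simplex :: "'v set \<Rightarrow> ('v \<Rightarrow> real) set" where
  "closed_simplex \<sigma> = {t. (\<forall>v. 0 \<le> t v) \<and> (\<forall>v. v \<notin> \<sigma> \<longrightarrow> t v = 0) \<and> (\<Sum>v\<in>\<sigma>. t v) = 1}"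

text \<open>
  The realization carries the weak topology: a set is open iff its trace on every closed
  simplex is open there. As every \<open>\<sigma> \<in> K\<close> is finite, the product topology restricted
  to \<open>closed_simplex \<sigma>\<close> is its Euclidean topology. (For an infinite complex the subspace topology
  of the product on the whole realization would in general be strictly coarser.)
\<close>

definition geometric_realization :: "'v set set \<Rightarrow> ('v \<Rightarrow> real) topology" where
  "geometric_realization K = topology (\<lambda>U. U \<subseteq> (\<Union>\<sigma>\<in>K. closed_simplex \<sigma>) \<and>
     (\<forall>\<sigma>\<in>K. openin (subtopology (powertop_real UNIV) (closed_simplex \<sigma>)) (U \<inter> closed_simplex \<sigma>)))"

lemma openin_geometric_realization:
  "openin (geometric_realization K) U \<longleftrightarrow> U \<subseteq> (\<Union>\<sigma>\<in>K. closed_simplex \<sigma>) \<and>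
     (\<forall>\<sigma>\<in>K. openin (subtopology (powertop_real UNIV) (closed_simplex \<sigma>)) (U \<inter> closed_simplex \<sigma>))"
proof -
  let ?P = "\<lambda>U. U \<subseteq> (\<Union>\<sigma>\<in>K. closed_simplex \<sigma>) \<and>
     (\<forall>\<sigma>\<in>K. openin (subtopology (powertop_real UNIV) (closed_simplex \<sigma>)) (U \<inter> closed_simplex \<sigma>))"
  have "istopology ?P"
    unfolding istopology_def
  proof (rule conjI; intro allI impI)
    fix S T assume S: "?P S" and T: "?P T"
    have "openin (subtopology (powertop_real UNIV) (closed_simplex \<sigma>)) ((S \<inter> T) \<inter> closed_simplex \<sigma>)"
      if "\<sigma> \<in> K" for \<sigma>
    proof -
      have "openin (subtopology (powertop_real UNIV) (closed_simplex \<sigma>))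
          ((S \<inter> closed_simplex \<sigma>) \<inter> (T \<inter> closed_simplex \<sigma>))"
        by (rule openin_Int) (use S T that in blast)+
      moreover have "(S \<inter> closed_simplex \<sigma>) \<inter> (T \<inter> closed_simplex \<sigma>) = (S \<inter> T) \<inter> closed_simplex \<sigma>"
        by blast
      ultimately show ?thesis by (simp only:)
    qed
    moreover have "S \<inter> T \<subseteq> (\<Union>\<sigma>\<in>K. closed_simplex \<sigma>)" using S by blast
    ultimately show "?P (S \<inter> T)" by blast
  next
    fix \<K> assume *: "\<forall>S\<in>\<K>. ?P S"
    have "openin (subtopology (powertop_real UNIV) (closed_simplex \<sigma>)) (\<Union>\<K> \<inter> closed_simplex \<sigma>)"
      if "\<sigma> \<in> K" for \<sigma>
    proof -
      have "openin (subtopology (powertop_real UNIV) (closed_simplex \<sigma>))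
          (\<Union>((\<lambda>S. S \<inter> closed_simplex \<sigma>) ` \<K>))"
        by (rule openin_Union) (use * that in blast)
      moreover have "\<Union>((\<lambda>S. S \<inter> closed_simplex \<sigma>) ` \<K>) = \<Union>\<K> \<inter> closed_simplex \<sigma>"
        by blast
      ultimately show ?thesis by (simp only:)
    qed
    moreover have "\<Union>\<K> \<subseteq> (\<Union>\<sigma>\<in>K. closed_simplex \<sigma>)" using * by blast
    ultimately show "?P (\<Union>\<K>)" by blast
  qed
  then show ?thesis
    unfolding geometric_realization_def by (simp add: topology_inverse')
qed

lemma topspace_geometric_realization:
  "topspace (geometric_realization K) = (\<Union>\<sigma>\<in>K. closed_simplex \<sigma>)"
proof
  show "topspace (geometric_realization K) \<subseteq> (\<Union>\<sigma>\<in>K. closed_simplex \<sigma>)"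
    using openin_topspace[of "geometric_realization K"] by (simp only: openin_geometric_realization)
  have "openin (geometric_realization K) (\<Union>\<sigma>\<in>K. closed_simplex \<sigma>)"
    unfolding openin_geometric_realization
  proof (intro conjI ballI)
    fix \<sigma> assume "\<sigma> \<in> K"
    then have "(\<Union>\<sigma>\<in>K. closed_simplex \<sigma>) \<inter> closed_simplex \<sigma> = closed_simplex \<sigma>" by blast
    then show "openin (subtopology (powertop_real UNIV) (closed_simplex \<sigma>))
        ((\<Union>\<sigma>\<in>K. closed_simplex \<sigma>) \<inter> closed_simplex \<sigma>)"
      by (simp add: openin_subtopology_refl)
  qed simp
  then show "(\<Union>\<sigma>\<in>K. closed_simplex \<sigma>) \<subseteq> topspace (geometric_realization K)"
    by (rule openin_subset)
qed

section \<open>Coset nerves\<close>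

definition left_cosets :: "('a, 'b) monoid_scheme \<Rightarrow> 'a set set \<Rightarrow> 'a set set" where
  "left_cosets G \<K> = {g <#\<^bsub>G\<^esub> H | g H. g \<in> carrier G \<and> H \<in> \<K>}"

definition coset_nerve :: "('a, 'b) monoid_scheme \<Rightarrow> 'a set set \<Rightarrow> 'a set set set" where
  "coset_nerve G \<K> = {\<sigma>. finite \<sigma> \<and> \<sigma> \<noteq> {} \<and> \<sigma> \<subseteq> left_cosets G \<K> \<and> \<Inter>\<sigma> \<noteq> {}}"

lemma coset_nerve_subset_closed:
  "\<lbrakk>\<sigma> \<in> coset_nerve G \<K>; \<tau> \<subseteq> \<sigma>; \<tau> \<noteq> {}\<rbrakk> \<Longrightarrow> \<tau> \<in> coset_nerve G \<K>"
  unfolding coset_nerve_def using finite_subset[of \<tau> \<sigma>] Inter_anti_mono[of \<tau> \<sigma>] by blast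

text \<open>
  The library predicate \<open>contractible_space\<close> also holds of the empty space. As usual,
  a contractible space (one homotopy equivalent to a point) is required to be nonempty here.
\<close>

definition contractible_nonempty :: "'t topology \<Rightarrow> bool" where
  "contractible_nonempty X \<longleftrightarrow> topspace X \<noteq> {} \<and> contractible_space X"

section \<open>Subgroups of finite index and complements\<close>

definition finite_index :: "('a, 'b) monoid_scheme \<Rightarrow> 'a set \<Rightarrow> bool" where
  "finite_index G H \<longleftrightarrow> finite (rcosets\<^bsub>G\<^esub> H)"

definition proper_normal_fi :: "('a, 'b) monoid_scheme \<Rightarrow> 'a set set" where
  "proper_normal_fi G = {N. N \<lhd> G \<and> N \<noteq> carrier G \<and> finite_index G N}"

definition maximal_elements :: "'a set set \<Rightarrow> 'a set set" where
  "maximal_elements \<K> = {M \<in> \<K>. \<forall>N\<in>\<K>. M \<subseteq> N \<longrightarrow> N = M}"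

text \<open>No condition is imposed on \<open>H \<inter> M\<close>.\<close>

definition is_complement :: "('a, 'b) monoid_scheme \<Rightarrow> 'a set \<Rightarrow> 'a set \<Rightarrow> bool" where
  "is_complement G H M \<longleftrightarrow>
     subgroup M G \<and> M \<noteq> carrier G \<and> carrier G = H <#>\<^bsub>G\<^esub> M"

end

theory Submission
  imports Defs "HOL-Homology.Brouwer_Degree" "HOL-Algebra.Zassenhaus"
begin

text \<open>
  If there are infinitely many maximal elements, only finitely many of them contain a given
  finite-index subgroup, and any other one meets all its cosets. So every finite set of vertices
  of the coset nerve has a cone vertex, and choosing cone vertices recursively over the finite
  vertex sets gives an explicit contraction.

  If there are only finitely many, choose maximal \<open>M\<^sub>0, \<dots>, M\<^sub>k\<^sub>-\<^sub>1\<close> such that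
  \<open>F\<^sub>i = \<Inter>\<^sub>j\<^sub><\<^sub>i M\<^sub>j\<close> decreases strictly to the intersection \<open>F\<^sub>k\<close> of all of them. Two cosets of
  each \<open>M\<^sub>i\<close> span the boundary of a cross-polytope in the nerve, that is, a \<open>(k - 1)\<close>-sphere. No
  normal subgroup lies strictly between \<open>F\<^sub>i\<^sub>+\<^sub>1\<close> and \<open>F\<^sub>i\<close>, so a simplex of the barycentric
  subdivision of this sphere, the flag \<open>F\<^sub>k \<subset> \<dots> \<subset> F\<^sub>1\<close>, is maximal in the order complex of cosets, and
  collapsing everything outside of it maps the nerve to a sphere. On the cross-polytope this map
  never points in the direction of its argument, so it is essential, whereas a map
  that factors through a contractible space is null-homotopic.
\<close>

section \<open>Maps into spheres\<close>

text \<open>No vertex is a cone vertex of the whole nerve, since a proper coset is disjoint from the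
  other cosets of its subgroup. The choice therefore depends on a finite vertex set, and it has to
  fit together along faces. This is why the vertex of a set must also be a cone vertex over the
  vertices already chosen for its proper subsets. The contraction is a formula in coordinates: the
  sets \<open>{v. r < t v}\<close> form a chain as \<open>r\<close> varies, and the lengths of the
  intervals of constancy serve as coordinates in a subdivided cone. The same device replaces the
  order complex in the other direction. A coset \<open>C\<close> need not be comparable with the
  flag, so it is enlarged to \<open>C <#> F k\<close>, which is still proper because all maximal
  elements contain \<open>F k\<close>. Intersecting these enlargements over
  \<open>{C. r < t C}\<close> gives a chain, recorded only through the numbers
  \<open>level i t\<close>. The collapse is represented by a nowhere vanishing vector
  \<open>q t\<close> with \<open>k\<close> coordinates instead of a quotient map; no degree is
  computed, only the direction of \<open>q\<close> is compared with that of its argument.\<close>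

lemma continuous_map_normalize_nsphere:
  assumes "\<And>i. i \<le> n \<Longrightarrow> continuous_map X euclideanreal (\<lambda>x. f x i)"
    and "\<And>x. x \<in> topspace X \<Longrightarrow> \<exists>i\<le>n. f x i \<noteq> 0"
  shows "continuous_map X (nsphere n) (\<lambda>x i. if i \<le> n then f x i / sqrt (\<Sum>j\<le>n. (f x j)\<^sup>2) else 0)"
proof -
  have pos: "(\<Sum>j\<le>n. (f x j)\<^sup>2) > 0" if x: "x \<in> topspace X" for x
  proof -
    obtain i where "i \<le> n" "f x i \<noteq> 0" using assms(2) [OF x] by blast
    then show ?thesis by (intro sum_pos2 [of _ i]) auto
  qed
  have "continuous_map X euclideanreal
      (\<lambda>x. if i \<le> n then f x i / sqrt (\<Sum>j\<le>n. (f x j)\<^sup>2) else 0)" for i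
  proof (cases "i \<le> n")
    case True
    have "continuous_map X euclideanreal (\<lambda>x. f x i / sqrt (\<Sum>j\<le>n. (f x j)\<^sup>2))"
      using pos by (intro continuous_intros assms True) (auto simp: less_le)
    then show ?thesis using True by simp
  qed simp
  moreover have "(\<Sum>i\<le>n. (f x i / sqrt (\<Sum>j\<le>n. (f x j)\<^sup>2))\<^sup>2) = 1" if "x \<in> topspace X" for x
  proof -
    have "(\<Sum>i\<le>n. (f x i / sqrt (\<Sum>j\<le>n. (f x j)\<^sup>2))\<^sup>2)
        = (\<Sum>i\<le>n. (f x i)\<^sup>2 / (\<Sum>j\<le>n. (f x j)\<^sup>2))"
      by (simp add: power_divide sum_nonneg)
    also have "\<dots> = (\<Sum>i\<le>n. (f x i)\<^sup>2) / (\<Sum>j\<le>n. (f x j)\<^sup>2)"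
      by (rule sum_divide_distrib [symmetric])
    also have "\<dots> = 1"
      using pos [OF that] by (intro divide_self) simp
    finally show ?thesis .
  qed
  ultimately show ?thesis
    by (auto simp: nsphere continuous_map_in_subtopology continuous_map_componentwise_UNIV)
qed

text \<open>Under these assumptions \<open>- q \<circ> e\<close>, normalized, is a self-map of the sphere that never
  hits the antipode, so it is homotopic to the identity; it is also null-homotopic, because it
  factors through \<open>X\<close>.\<close>

lemma not_contractible_space_if_sphere_map:
  fixes q :: "'x \<Rightarrow> nat \<Rightarrow> real"
  assumes e: "continuous_map (nsphere n) X e"
    and q: "\<And>i. i \<le> n \<Longrightarrow> continuous_map X euclideanreal (\<lambda>x. q x i)"
    and nz: "\<And>x. x \<in> topspace X \<Longrightarrow> \<exists>i\<le>n. q x i \<noteq> 0"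
    and nm: "\<And>c \<mu>. c \<in> topspace (nsphere n) \<Longrightarrow> 0 \<le> \<mu> \<Longrightarrow> \<exists>i\<le>n. q (e c) i \<noteq> \<mu> * c i"
  shows "\<not> contractible_space X"
proof
  assume X: "contractible_space X"
  let ?nrm = "\<lambda>f (i::nat). if i \<le> n then f i / sqrt (\<Sum>j\<le>n. (f j)\<^sup>2) else 0 :: real"
  define g where "g x = ?nrm (\<lambda>i. - q x i)" for x
  have g: "continuous_map X (nsphere n) g"
    unfolding g_def using q nz by (intro continuous_map_normalize_nsphere) (auto intro!: continuous_intros)
  obtain b where b: "homotopic_with (\<lambda>h. True) (nsphere n) (nsphere n) (g \<circ> e) (\<lambda>x. b)"
    using nullhomotopic_through_contractible_space [OF e g X] .
  have ge: "continuous_map (nsphere n) (nsphere n) (g \<circ> e)"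
    by (rule continuous_map_compose [OF e g])
  let ?T = "prod_topology (top_of_set {0..1::real}) (nsphere n)"
  let ?l = "\<lambda>(s, c) i. (1 - s) * c i + s * (g \<circ> e) c i"
  have proj: "continuous_map ?T euclideanreal (\<lambda>z. snd z i)"
    "continuous_map ?T euclideanreal (\<lambda>z. (g \<circ> e) (snd z) i)" for i
    using continuous_map_compose [OF continuous_map_snd continuous_map_nsphere_projection]
      continuous_map_compose [OF continuous_map_snd continuous_map_compose [OF ge continuous_map_nsphere_projection]]
    by (simp_all add: o_def)
  have fst: "continuous_map ?T euclideanreal fst"
    by (intro continuous_map_into_fulltopology [OF continuous_map_fst])
  have "continuous_map ?T (nsphere n) (\<lambda>z. ?nrm (?l z))"
  proof (rule continuous_map_normalize_nsphere)
    show "continuous_map ?T euclideanreal (\<lambda>z. ?l z i)" for i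
      unfolding case_prod_unfold by (intro continuous_intros proj fst)
    show "\<exists>i\<le>n. ?l z i \<noteq> 0" if zT: "z \<in> topspace ?T" for z
    proof -
      obtain s c where z: "z = (s, c)" "0 \<le> s" "s \<le> 1" "c \<in> topspace (nsphere n)"
        using zT by (cases z) auto
      have ec: "e c \<in> topspace X"
        using e z(4) by (auto simp: continuous_map_def)
      define r where "r = sqrt (\<Sum>j\<le>n. (q (e c) j)\<^sup>2)"
      have gq: "g (e c) i = - q (e c) i / r" if "i \<le> n" for i
        using that by (simp add: g_def r_def)
      have r: "r > 0"
      proof -
        obtain i where "i \<le> n" "q (e c) i \<noteq> 0" using nz [OF ec] by blast
        then show ?thesis unfolding r_def by (auto intro!: sum_pos2 [of _ i])
      qed
      show ?thesis
      proof (cases "s = 0")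
        case True
        have "\<exists>i\<le>n. c i \<noteq> 0"
        proof (rule ccontr)
          assume "\<not> ?thesis"
          then have "(\<Sum>i\<le>n. (c i)\<^sup>2) = 0" by simp
          then show False using z(4) by (simp add: nsphere)
        qed
        then show ?thesis using True z(1) by simp
      next
        case False
        \<comment> \<open>The segment from \<open>c\<close> to \<open>g (e c)\<close> passes through
          0 at parameter \<open>s\<close> only if \<open>q (e c)\<close> equals \<open>c\<close>
          times this factor, which \<open>nm\<close> forbids.\<close>
        have "0 \<le> (1 - s) * r / s" using z r by simp
        then obtain i where i: "i \<le> n" "q (e c) i \<noteq> (1 - s) * r / s * c i"
          using nm [OF z(4)] by blast
        have "(1 - s) * c i + s * (- q (e c) i / r) \<noteq> 0"
          using i(2) r False by (auto simp: field_simps)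
        then show ?thesis using i z gq by auto
      qed
    qed
  qed
  moreover have nrm: "?nrm c = c" if "c \<in> topspace (nsphere n)" for c
    using that by (auto simp: nsphere)
  have "?nrm (?l (0, c)) = c" "?nrm (?l (1, c)) = (g \<circ> e) c" if "c \<in> topspace (nsphere n)" for c
  proof -
    have "(g \<circ> e) c \<in> topspace (nsphere n)"
      using ge that by (auto simp: continuous_map_def)
    moreover have "?l (0, c) = c" "?l (1, c) = (g \<circ> e) c" by auto
    ultimately show "?nrm (?l (0, c)) = c" "?nrm (?l (1, c)) = (g \<circ> e) c"
      using nrm that by presburger+
  qed
  ultimately have "homotopic_with (\<lambda>h. True) (nsphere n) (nsphere n) id (g \<circ> e)"
    by (subst homotopic_with) (auto intro!: exI [of _ "\<lambda>z. ?nrm (?l z)"])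
  then have "homotopic_with (\<lambda>h. True) (nsphere n) (nsphere n) id (\<lambda>x. b)"
    using b by (rule homotopic_with_trans)
  then have "contractible_space (nsphere n)"
    unfolding contractible_space_def by blast
  then show False
    using non_contractible_space_nsphere by blast
qed

section \<open>Continuity for the weak topology\<close>

lemma closedin_closed_simplex: "closedin (powertop_real UNIV) (closed_simplex \<sigma>)"
proof -
  have c: "continuous_on UNIV (\<lambda>t::'a \<Rightarrow> real. t v)" for v
    by (rule continuous_on_product_coordinates)
  have "closed {t::'a \<Rightarrow> real. (\<forall>v. 0 \<le> t v) \<and> (\<forall>v. v \<notin> \<sigma> \<longrightarrow> t v = 0) \<and> (\<Sum>v\<in>\<sigma>. t v) = 1}"
    by (intro closed_Collect_conj closed_Collect_all closed_Collect_imp closed_Collect_le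
        closed_Collect_eq continuous_intros c) auto
  then show ?thesis
    by (simp add: closed_simplex_def euclidean_product_topology)
qed

lemma continuous_map_geometric_realization:
  assumes "\<And>\<sigma>. \<sigma> \<in> K \<Longrightarrow> continuous_map (subtopology (powertop_real UNIV) (closed_simplex \<sigma>)) Y f"
  shows "continuous_map (geometric_realization K) Y f"
  unfolding continuous_map_def
proof (intro conjI allI impI)
  show "f \<in> topspace (geometric_realization K) \<rightarrow> topspace Y"
    using assms by (fastforce simp: topspace_geometric_realization continuous_map_def)
  fix U assume U: "openin Y U"
  have "openin (subtopology (powertop_real UNIV) (closed_simplex \<sigma>))
      ({x \<in> topspace (geometric_realization K). f x \<in> U} \<inter> closed_simplex \<sigma>)" if "\<sigma> \<in> K" for \<sigma>
  proof -
    have "{x \<in> topspace (geometric_realization K). f x \<in> U} \<inter> closed_simplex \<sigma>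
        = {x \<in> closed_simplex \<sigma>. f x \<in> U}"
      using that by (auto simp: topspace_geometric_realization)
    then show ?thesis
      using openin_continuous_map_preimage [OF assms [OF that] U] by simp
  qed
  then show "openin (geometric_realization K) {x \<in> topspace (geometric_realization K). f x \<in> U}"
    unfolding openin_geometric_realization by (auto simp: topspace_geometric_realization)
qed

text \<open>The weak topology may be finer than the product topology, so continuity of the
  coordinates alone is not enough. On a finite union of closed simplices the two agree: the trace of
  a weakly closed set is a finite union of sets closed in the product.\<close>

lemma continuous_map_into_geometric_realization:
  assumes f: "continuous_map X (powertop_real UNIV) f"
    and S: "finite S" "S \<subseteq> K" and im: "f \<in> topspace X \<rightarrow> (\<Union>\<sigma>\<in>S. closed_simplex \<sigma>)"
  shows "continuous_map X (geometric_realization K) f"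
  unfolding continuous_map_closedin
proof (intro conjI allI impI ballI)
  show "f \<in> topspace X \<rightarrow> topspace (geometric_realization K)"
    using im S(2) by (fastforce simp: topspace_geometric_realization)
  fix C assume C: "closedin (geometric_realization K) C"
  have "closedin (powertop_real UNIV) (C \<inter> closed_simplex \<sigma>)" if "\<sigma> \<in> S" for \<sigma>
  proof -
    have "openin (geometric_realization K) (topspace (geometric_realization K) - C)"
      using C by (simp add: closedin_def)
    then have "openin (subtopology (powertop_real UNIV) (closed_simplex \<sigma>))
        ((topspace (geometric_realization K) - C) \<inter> closed_simplex \<sigma>)"
      using that S(2) unfolding openin_geometric_realization by blast
    moreover have "(topspace (geometric_realization K) - C) \<inter> closed_simplex \<sigma>
        = closed_simplex \<sigma> - C \<inter> closed_simplex \<sigma>"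
      using that S(2) by (auto simp: topspace_geometric_realization)
    ultimately have "closedin (subtopology (powertop_real UNIV) (closed_simplex \<sigma>)) (C \<inter> closed_simplex \<sigma>)"
      by (simp add: closedin_def)
    then show ?thesis
      using closedin_closed_simplex closedin_trans_full by blast
  qed
  then have "closedin X {x \<in> topspace X. f x \<in> C \<inter> closed_simplex \<sigma>}" if "\<sigma> \<in> S" for \<sigma>
    using that closedin_continuous_map_preimage [OF f] by blast
  then have "closedin X (\<Union>\<sigma>\<in>S. {x \<in> topspace X. f x \<in> C \<inter> closed_simplex \<sigma>})"
    using S(1) by (intro closedin_Union) auto
  moreover have "(\<Union>\<sigma>\<in>S. {x \<in> topspace X. f x \<in> C \<inter> closed_simplex \<sigma>}) = {x \<in> topspace X. f x \<in> C}"
    using im by fastforce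
  ultimately show "closedin X {x \<in> topspace X. f x \<in> C}" by simp
qed

text \<open>A product with the weak topology need not carry the weak topology; here it does because
  the interval is locally compact.\<close>

lemma continuous_map_interval_geometric_realization:
  assumes f: "\<And>\<sigma>. \<sigma> \<in> K \<Longrightarrow> continuous_map (prod_topology (top_of_set {0..1::real})
      (subtopology (powertop_real UNIV) (closed_simplex \<sigma>))) Y f"
  shows "continuous_map (prod_topology (top_of_set {0..1::real}) (geometric_realization K)) Y f"
  unfolding continuous_map_def
proof (intro conjI allI impI)
  let ?I = "top_of_set {0..1::real}" and ?R = "geometric_realization K"
  let ?X = "prod_topology ?I ?R"
  let ?S = "\<lambda>\<sigma>::'a set. subtopology (powertop_real UNIV) (closed_simplex \<sigma>)"
  show "f \<in> topspace ?X \<rightarrow> topspace Y"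
    using f by (fastforce simp: topspace_geometric_realization continuous_map_def)
  fix U assume U: "openin Y U"
  let ?U = "{x \<in> topspace ?X. f x \<in> U}"
  have tr: "openin (prod_topology ?I (?S \<sigma>)) {x \<in> {0..1} \<times> closed_simplex \<sigma>. f x \<in> U}" if "\<sigma> \<in> K" for \<sigma>
    using openin_continuous_map_preimage [OF f [OF that] U] by simp
  show "openin ?X ?U"
    unfolding openin_prod_topology_alt
  proof (intro allI impI)
    fix s t assume "(s, t) \<in> ?U"
    then have "s \<in> {0..1}" "t \<in> (\<Union>\<sigma>\<in>K. closed_simplex \<sigma>)" and fU: "f (s, t) \<in> U"
      by (simp_all add: topspace_geometric_realization)
    then obtain \<sigma> where s: "s \<in> {0..1}" and \<sigma>: "\<sigma> \<in> K" "t \<in> closed_simplex \<sigma>"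
      by blast
    have st: "(s, t) \<in> {x \<in> {0..1} \<times> closed_simplex \<sigma>. f x \<in> U}"
      using s \<sigma>(2) fU by simp
    obtain A B where AB: "openin ?I A" "openin (?S \<sigma>) B" "s \<in> A" "t \<in> B"
        "A \<times> B \<subseteq> {x \<in> {0..1} \<times> closed_simplex \<sigma>. f x \<in> U}"
      using tr [OF \<sigma>(1), THEN openin_prod_topology_alt [THEN iffD1], rule_format, OF st]
      by (elim exE conjE)
    obtain d where d: "d > 0" "\<And>x. x \<in> {0..1} \<Longrightarrow> dist x s < d \<Longrightarrow> x \<in> A"
      using AB(1,3) unfolding openin_euclidean_subtopology_iff by blast
    \<comment> \<open>Local compactness enters here: \<open>J\<close> is a compact neighbourhood of
      \<open>s\<close> inside \<open>A\<close>, the halved radius keeping the closed ball within it.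
      By the tube lemma the set \<open>W\<close> of all \<open>u\<close> with
      \<open>J \<times> {u}\<close> mapped into \<open>U\<close> is then open in every
      simplex.\<close>
    define J where "J = {0..1} \<inter> cball s (d/2)"
    have J: "compactin ?I J" "J \<subseteq> A"
    proof -
      have "compact J" unfolding J_def by (intro compact_Int) auto
      then show "compactin ?I J" by (auto simp: J_def compactin_subtopology)
      show "J \<subseteq> A" using d by (auto simp: J_def dist_commute)
    qed
    define W where "W = {u \<in> topspace ?R. \<forall>x\<in>J. f (x, u) \<in> U}"
    have "openin (?S \<tau>) (W \<inter> closed_simplex \<tau>)" if \<tau>: "\<tau> \<in> K" for \<tau>
    proof (subst openin_subopen, intro ballI)
      fix u assume u: "u \<in> W \<inter> closed_simplex \<tau>"
      have "J \<times> {u} \<subseteq> {x \<in> {0..1} \<times> closed_simplex \<tau>. f x \<in> U}"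
        using u by (auto simp: W_def J_def)
      then obtain P Q where PQ: "openin ?I P" "openin (?S \<tau>) Q" "J \<subseteq> P" "u \<in> Q"
          "P \<times> Q \<subseteq> {x \<in> {0..1} \<times> closed_simplex \<tau>. f x \<in> U}"
        using tube_lemma_left [OF tr [OF \<tau>] J(1), of u] u by auto
      have "Q \<subseteq> W \<inter> closed_simplex \<tau>"
      proof
        fix w assume w: "w \<in> Q"
        have "w \<in> closed_simplex \<tau>" using openin_subset [OF PQ(2)] w by auto
        then show "w \<in> W \<inter> closed_simplex \<tau>"
          using PQ(3,5) w \<tau> unfolding W_def topspace_geometric_realization by blast
      qed
      then show "\<exists>T. openin (?S \<tau>) T \<and> u \<in> T \<and> T \<subseteq> W \<inter> closed_simplex \<tau>"
        using PQ by blast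
    qed
    then have W: "openin ?R W"
      unfolding openin_geometric_realization by (auto simp: W_def topspace_geometric_realization)
    have "t \<in> W"
      using AB J(2) \<sigma> by (auto simp: W_def topspace_geometric_realization)
    moreover have "openin ?I ({0..1} \<inter> ball s (d/2))"
      by (auto intro: openin_open_Int)
    moreover have "({0..1} \<inter> ball s (d/2)) \<times> W \<subseteq> ?U"
      by (auto simp: W_def J_def)
    ultimately show "\<exists>V W. openin ?I V \<and> openin ?R W \<and> s \<in> V \<and> t \<in> W \<and> V \<times> W \<subseteq> ?U"
      using W s d(1) by (intro exI [of _ "{0..1} \<inter> ball s (d/2)"] exI [of _ W]) auto
  qed
qed

section \<open>Complexes in which finite vertex sets have cone vertices\<close>

text \<open>The sets \<open>A\<close> used later, complements and families of cosets, may be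
  infinite. For finitely supported \<open>t\<close> the image is still finite, so \<open>Max\<close>
  is a true supremum; the inserted 0 covers empty \<open>A\<close> and changes nothing else for
  nonnegative \<open>t\<close>.\<close>

definition sup_on :: "'v set \<Rightarrow> ('v \<Rightarrow> real) \<Rightarrow> real" where
  "sup_on A t = Max (insert 0 (t ` A))"

lemma sup_on_restrict:
  assumes "\<And>v. v \<notin> S \<Longrightarrow> t v = 0"
  shows "sup_on A t = Max (insert 0 (t ` (A \<inter> S)))"
proof -
  have "insert 0 (t ` A) = insert 0 (t ` (A \<inter> S))"
    using assms by force
  then show ?thesis by (simp add: sup_on_def)
qed

lemma sup_on_bounds:
  assumes "finite S" "\<And>v. v \<notin> S \<Longrightarrow> t v = 0"
  shows "sup_on A t \<le> r \<longleftrightarrow> 0 \<le> r \<and> (\<forall>v\<in>A. t v \<le> r)"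
    and "sup_on A t < r \<longleftrightarrow> 0 < r \<and> (\<forall>v\<in>A. t v < r)"
    and "sup_on A t = 0 \<or> (\<exists>v\<in>A. sup_on A t = t v)"
    and "0 \<le> sup_on A t" and "v \<in> A \<Longrightarrow> t v \<le> sup_on A t"
proof -
  have "t ` A \<subseteq> insert 0 (t ` S)" using assms(2) by force
  then have f: "finite (t ` A)" using assms(1) by (meson finite_imageI finite_insert finite_subset)
  then show "sup_on A t \<le> r \<longleftrightarrow> 0 \<le> r \<and> (\<forall>v\<in>A. t v \<le> r)"
    "sup_on A t < r \<longleftrightarrow> 0 < r \<and> (\<forall>v\<in>A. t v < r)" "0 \<le> sup_on A t"
    "v \<in> A \<Longrightarrow> t v \<le> sup_on A t"
    by (auto simp: sup_on_def)
  have "sup_on A t \<in> insert 0 (t ` A)"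
    unfolding sup_on_def using f by (intro Max_in) auto
  then show "sup_on A t = 0 \<or> (\<exists>v\<in>A. sup_on A t = t v)" by auto
qed

lemma continuous_map_Max_insert:
  assumes "finite A" "continuous_map X euclideanreal g"
    and "\<And>u. u \<in> A \<Longrightarrow> continuous_map X euclideanreal (f u)"
  shows "continuous_map X euclideanreal (\<lambda>x. Max (insert (g x) ((\<lambda>u. f u x) ` A)))"
  using assms(1,3)
proof (induction A)
  case (insert a A)
  have "Max (insert (g x) ((\<lambda>u. f u x) ` insert a A)) = max (f a x) (Max (insert (g x) ((\<lambda>u. f u x) ` A)))" for x
    using insert.hyps by (simp add: insert_commute [of "g x"])
  then show ?case using insert by (simp add: continuous_map_real_max)
qed (use assms in simp)

lemma continuous_map_Min_insert:
  assumes "finite A" "continuous_map X euclideanreal g"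
    and "\<And>u. u \<in> A \<Longrightarrow> continuous_map X euclideanreal (f u)"
  shows "continuous_map X euclideanreal (\<lambda>x. Min (insert (g x) ((\<lambda>u. f u x) ` A)))"
  using assms(1,3)
proof (induction A)
  case (insert a A)
  have "Min (insert (g x) ((\<lambda>u. f u x) ` insert a A)) = min (f a x) (Min (insert (g x) ((\<lambda>u. f u x) ` A)))" for x
    using insert.hyps by (simp add: insert_commute [of "g x"])
  then show ?case using insert by (simp add: continuous_map_real_min)
qed (use assms in simp)

lemma continuous_map_sup_on:
  assumes "finite S" "\<And>u. u \<in> S \<Longrightarrow> continuous_map X euclideanreal (\<lambda>x. t x u)"
    and "\<And>x u. x \<in> topspace X \<Longrightarrow> u \<notin> S \<Longrightarrow> t x u = 0"
  shows "continuous_map X euclideanreal (\<lambda>x. sup_on A (t x))"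
proof (rule continuous_map_eq)
  show "continuous_map X euclideanreal (\<lambda>x. Max (insert 0 ((\<lambda>u. t x u) ` (A \<inter> S))))"
    using assms by (intro continuous_map_Max_insert) auto
  show "Max (insert 0 ((\<lambda>u. t x u) ` (A \<inter> S))) = sup_on A (t x)" if "x \<in> topspace X" for x
    using assms(3) [OF that] by (intro sup_on_restrict [symmetric]) auto
qed

lemma closed_simplexD:
  assumes "t \<in> closed_simplex \<sigma>"
  shows "0 \<le> t v" "v \<notin> \<sigma> \<Longrightarrow> t v = 0" "(\<Sum>v\<in>\<sigma>. t v) = 1"
  using assms by (auto simp: closed_simplex_def)

lemma continuous_map_closed_simplex_coordinate:
  "continuous_map (subtopology (powertop_real UNIV) (closed_simplex \<sigma>)) euclideanreal (\<lambda>t. t v)"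
  by (intro continuous_map_from_subtopology continuous_map_product_projection) simp

lemma continuous_map_geometric_realization_sup_on:
  assumes "\<And>\<sigma>. \<sigma> \<in> K \<Longrightarrow> finite \<sigma>"
  shows "continuous_map (geometric_realization K) euclideanreal (sup_on A)"
proof (rule continuous_map_geometric_realization)
  fix \<sigma> assume "\<sigma> \<in> K"
  then show "continuous_map (subtopology (powertop_real UNIV) (closed_simplex \<sigma>)) euclideanreal (sup_on A)"
    using assms closed_simplexD(2) by (intro continuous_map_sup_on [of \<sigma> _ "\<lambda>t. t", simplified])
      (auto intro: continuous_map_closed_simplex_coordinate)
qed

text \<open>The Lebesgue measure of the set of those \<open>s \<in> {0<..<\<omega>}\<close> with \<open>{v. s < t v} = \<sigma>\<close>.\<close>

definition level_weight :: "'v set \<Rightarrow> real \<Rightarrow> ('v \<Rightarrow> real) \<Rightarrow> real" where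
  "level_weight \<sigma> \<omega> t = max 0 (Min (insert \<omega> (t ` \<sigma>)) - sup_on (- \<sigma>) t)"

lemma level_weight_nonneg [simp]: "0 \<le> level_weight \<sigma> \<omega> t"
  by (simp add: level_weight_def)

lemma level_weight_pos_iff:
  assumes "finite S" "\<And>v. v \<notin> S \<Longrightarrow> t v = 0" "finite \<sigma>"
  shows "0 < level_weight \<sigma> \<omega> t \<longleftrightarrow> 0 < \<omega> \<and> (\<forall>u\<in>\<sigma>. 0 < t u) \<and> (\<forall>v\<in>-\<sigma>. t v < \<omega> \<and> (\<forall>u\<in>\<sigma>. t v < t u))"
proof -
  have "0 < level_weight \<sigma> \<omega> t \<longleftrightarrow> (\<forall>r\<in>insert \<omega> (t ` \<sigma>). sup_on (- \<sigma>) t < r)"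
    using assms(3) by (simp add: level_weight_def less_max_iff_disj)
  then show ?thesis
    using sup_on_bounds(2) [OF assms(1,2)] by auto
qed

lemma continuous_map_level_weight:
  assumes "finite S" "\<And>u. u \<in> S \<Longrightarrow> continuous_map X euclideanreal (\<lambda>x. t x u)"
    and "\<And>x u. x \<in> topspace X \<Longrightarrow> u \<notin> S \<Longrightarrow> t x u = 0"
    and "continuous_map X euclideanreal w" and "\<sigma> \<subseteq> S"
  shows "continuous_map X euclideanreal (\<lambda>x. level_weight \<sigma> (w x) (t x))"
  unfolding level_weight_def using assms finite_subset [OF assms(5,1)]
  by (intro continuous_map_real_max continuous_map_diff continuous_map_Min_insert
      continuous_map_sup_on [of S] continuous_map_const [THEN iffD2]) auto

text \<open>Here \<open>\<omega>\<close> is the weight of the cone vertex. What exceeds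
  \<open>\<omega>\<close> stays at its vertex; below \<open>\<omega>\<close>, each height
  \<open>s\<close> contributes to the vertex chosen for the superlevel set
  \<open>{v. s < t v}\<close>. The weights are not normalized, hence the later division by
  \<open>cone_total\<close>.\<close>

definition cone_weight :: "('v set \<Rightarrow> 'v) \<Rightarrow> 'v set \<Rightarrow> real \<Rightarrow> ('v \<Rightarrow> real) \<Rightarrow> 'v \<Rightarrow> real" where
  "cone_weight c S \<omega> t u =
     max 0 (t u - \<omega>) + (\<Sum>\<sigma>\<in>Pow S. if c \<sigma> = u then level_weight \<sigma> \<omega> t else 0)"

definition cone_total :: "'v set \<Rightarrow> real \<Rightarrow> ('v \<Rightarrow> real) \<Rightarrow> real" where
  "cone_total S \<omega> t = (\<Sum>u\<in>S. max 0 (t u - \<omega>)) + (\<Sum>\<sigma>\<in>Pow S. level_weight \<sigma> \<omega> t)"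

lemma level_weight_eq_0:
  assumes "finite S" "\<And>v. v \<notin> S \<Longrightarrow> t v = 0" "finite \<sigma>" "\<not> \<sigma> \<subseteq> S"
  shows "level_weight \<sigma> \<omega> t = 0"
proof (rule ccontr)
  assume "level_weight \<sigma> \<omega> t \<noteq> 0"
  then have "0 < level_weight \<sigma> \<omega> t" by (simp add: less_le)
  then show False using level_weight_pos_iff [OF assms(1-3)] assms(2,4) by force
qed

text \<open>Superlevel sets at positive height lie in the support of \<open>t\<close>, so further
  subsets of \<open>S'\<close> have weight 0. The homotopy thus does not depend on the simplex in
  which it is computed.\<close>

lemma cone_weight_cong:
  assumes "finite S'" "S \<subseteq> S'" "\<And>v. v \<notin> S \<Longrightarrow> t v = 0"
  shows "cone_weight c S \<omega> t = cone_weight c S' \<omega> t"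
proof -
  have "finite S" using assms finite_subset by blast
  then have "(\<Sum>\<sigma>\<in>Pow S. if c \<sigma> = u then level_weight \<sigma> \<omega> t else 0)
      = (\<Sum>\<sigma>\<in>Pow S'. if c \<sigma> = u then level_weight \<sigma> \<omega> t else 0)" for u
    using assms by (intro sum.mono_neutral_left) (auto intro!: level_weight_eq_0 [of S] intro: finite_subset)
  then show ?thesis by (simp add: cone_weight_def fun_eq_iff)
qed

lemma cone_total_cong:
  assumes "finite S'" "S \<subseteq> S'" "\<And>v. v \<notin> S \<Longrightarrow> t v = 0" "0 \<le> \<omega>"
  shows "cone_total S \<omega> t = cone_total S' \<omega> t"
proof -
  have "finite S" using assms finite_subset by blast
  then have "(\<Sum>\<sigma>\<in>Pow S. level_weight \<sigma> \<omega> t) = (\<Sum>\<sigma>\<in>Pow S'. level_weight \<sigma> \<omega> t)"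
    using assms by (intro sum.mono_neutral_left) (auto intro!: level_weight_eq_0 [of S] intro: finite_subset)
  moreover have "(\<Sum>u\<in>S. max 0 (t u - \<omega>)) = (\<Sum>u\<in>S'. max 0 (t u - \<omega>))"
    using assms by (intro sum.mono_neutral_left) auto
  ultimately show ?thesis by (simp add: cone_total_def)
qed

lemma cone_weight_nonneg: "0 \<le> cone_weight c S \<omega> t u"
  by (auto simp: cone_weight_def intro!: add_nonneg_nonneg sum_nonneg)

lemma sum_cone_weight:
  assumes "finite B" "S \<subseteq> B" "c ` Pow S \<subseteq> B" "\<And>v. v \<notin> S \<Longrightarrow> t v = 0" "0 \<le> \<omega>"
  shows "(\<Sum>u\<in>B. cone_weight c S \<omega> t u) = cone_total S \<omega> t"
proof -
  have "(\<Sum>u\<in>B. max 0 (t u - \<omega>)) = (\<Sum>u\<in>S. max 0 (t u - \<omega>))"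
    using assms by (intro sum.mono_neutral_right) auto
  moreover have "(\<Sum>u\<in>B. \<Sum>\<sigma>\<in>Pow S. if c \<sigma> = u then level_weight \<sigma> \<omega> t else 0)
      = (\<Sum>\<sigma>\<in>Pow S. \<Sum>u\<in>B. if c \<sigma> = u then level_weight \<sigma> \<omega> t else 0)"
    by (rule sum.swap)
  moreover have "(\<Sum>u\<in>B. if c \<sigma> = u then level_weight \<sigma> \<omega> t else 0) = level_weight \<sigma> \<omega> t"
    if "\<sigma> \<in> Pow S" for \<sigma>
    using that assms(1,3) by auto
  ultimately show ?thesis
    by (simp add: cone_weight_def cone_total_def sum.distrib)
qed

lemma cone_total_pos:
  assumes "finite S" "\<And>v. v \<notin> S \<Longrightarrow> t v = 0" "0 < \<omega> \<or> (\<exists>v. \<omega> < t v)" "0 \<le> \<omega>"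
  shows "0 < cone_total S \<omega> t"
proof (cases "\<omega> = 0")
  case True
  then obtain v where v: "\<omega> < t v" using assms(3) by auto
  then have "v \<in> S" using assms(2,4) by (metis not_less)
  then have "0 < (\<Sum>u\<in>S. max 0 (t u - \<omega>))"
    using v assms(1) by (intro sum_pos2 [of _ v]) auto
  then show ?thesis by (auto simp: cone_total_def intro!: add_pos_nonneg sum_nonneg)
next
  case False
  then have \<omega>: "0 < \<omega>" using assms(4) by simp
  \<comment> \<open>This is the superlevel set at all heights just below \<open>\<omega>\<close>, so
    its interval has positive length.\<close>
  define \<sigma> where "\<sigma> = {u. \<omega> \<le> t u}"
  have "\<sigma> \<subseteq> S" using \<omega> assms(2) unfolding \<sigma>_def by force
  moreover then have "0 < level_weight \<sigma> \<omega> t"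
    using \<omega> assms(1) finite_subset by (subst level_weight_pos_iff [of S]) (auto simp: \<sigma>_def assms(2))
  ultimately have "0 < (\<Sum>\<sigma>\<in>Pow S. level_weight \<sigma> \<omega> t)"
    using assms(1) by (intro sum_pos2 [of _ \<sigma>]) auto
  then show ?thesis by (auto simp: cone_total_def intro!: add_nonneg_pos sum_nonneg)
qed

lemma cone_weight_support:
  assumes "finite S" "0 < cone_weight c S \<omega> t u"
  shows "u \<in> {u. \<omega> < t u} \<union> c ` {\<sigma> \<in> Pow S. 0 < level_weight \<sigma> \<omega> t}"
proof (rule ccontr)
  assume u: "\<not> ?thesis"
  then have "max 0 (t u - \<omega>) = 0" by auto
  moreover have "(\<Sum>\<sigma>\<in>Pow S. if c \<sigma> = u then level_weight \<sigma> \<omega> t else 0) = 0"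
    using u by (intro sum.neutral) (auto simp: less_le)
  ultimately show False using assms(2) by (simp add: cone_weight_def)
qed

text \<open>Well-founded recursion over finite sets: \<open>c \<sigma>\<close> is a cone vertex for
  the finite set consisting of \<open>\<sigma>\<close> and all earlier values
  \<open>c \<tau>\<close>. Applied to \<open>\<rho> = {}\<close>, the requirement shows that these
  values are themselves vertices, so that \<open>cone\<close> is applicable at the next
  stage.\<close>

lemma exists_cone_vertices:
  assumes cone: "\<And>B. finite B \<Longrightarrow> B \<subseteq> \<Union>K \<Longrightarrow> \<exists>w. \<forall>\<rho>\<subseteq>B. \<rho> \<in> K \<or> \<rho> = {} \<longrightarrow> insert w \<rho> \<in> K"
  obtains c where "\<And>\<sigma> \<rho>. finite \<sigma> \<Longrightarrow> \<sigma> \<subseteq> \<Union>K \<Longrightarrow> \<rho> \<subseteq> \<sigma> \<union> c ` {\<tau>. \<tau> \<subset> \<sigma>} \<Longrightarrow>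
    \<rho> \<in> K \<or> \<rho> = {} \<Longrightarrow> insert (c \<sigma>) \<rho> \<in> K"
proof -
  define P where "P c \<sigma> r \<longleftrightarrow> (finite \<sigma> \<and> \<sigma> \<subseteq> \<Union>K \<longrightarrow>
    (\<forall>\<rho>\<subseteq>\<sigma> \<union> c ` {\<tau>. \<tau> \<subset> \<sigma>}. \<rho> \<in> K \<or> \<rho> = {} \<longrightarrow> insert r \<rho> \<in> K))" for c \<sigma> r
  have "\<exists>c. \<forall>\<sigma>. P c \<sigma> (c \<sigma>)"
  proof (rule dependent_wf_choice [OF wf_finite_psubset])
    fix f g :: "'a set \<Rightarrow> 'a" and \<sigma> r
    assume eq: "\<And>\<tau>. (\<tau>, \<sigma>) \<in> finite_psubset \<Longrightarrow> f \<tau> = g \<tau>"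
    have "f ` {\<tau>. \<tau> \<subset> \<sigma>} = g ` {\<tau>. \<tau> \<subset> \<sigma>}" if "finite \<sigma>"
      using that by (intro image_cong) (auto simp: eq finite_psubset_def)
    then show "P f \<sigma> r = P g \<sigma> r"
      unfolding P_def by (cases "finite \<sigma>") simp_all
  next
    fix c \<sigma>
    assume IH: "\<And>\<tau>. (\<tau>, \<sigma>) \<in> finite_psubset \<Longrightarrow> P c \<tau> (c \<tau>)"
    show "\<exists>r. P c \<sigma> r"
    proof (cases "finite \<sigma> \<and> \<sigma> \<subseteq> \<Union>K")
      case True
      have "c \<tau> \<in> \<Union>K" if "\<tau> \<subset> \<sigma>" for \<tau>
      proof -
        have "P c \<tau> (c \<tau>)" using IH that True by (simp add: finite_psubset_def)
        then have "{c \<tau>} \<in> K" using that True finite_subset unfolding P_def by blast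
        then show ?thesis by blast
      qed
      moreover have "finite {\<tau>. \<tau> \<subset> \<sigma>}"
        by (rule finite_subset [of _ "Pow \<sigma>"]) (use True in auto)
      ultimately have "\<exists>r. \<forall>\<rho>\<subseteq>\<sigma> \<union> c ` {\<tau>. \<tau> \<subset> \<sigma>}. \<rho> \<in> K \<or> \<rho> = {} \<longrightarrow> insert r \<rho> \<in> K"
        using True by (intro cone) auto
      then show ?thesis by (simp add: P_def)
    qed (auto simp: P_def)
  qed
  then show thesis using that unfolding P_def by metis
qed

text \<open>Remove the largest member \<open>A\<close> of the chain. The remaining simplex lies in
  \<open>A\<close> together with the values of \<open>c\<close> at proper subsets of
  \<open>A\<close>, so it can be coned off with \<open>c A\<close>.\<close>

lemma cone_vertices_chain:
  assumes c: "\<And>\<sigma> \<rho>. finite \<sigma> \<Longrightarrow> \<sigma> \<subseteq> \<Union>K \<Longrightarrow> \<rho> \<subseteq> \<sigma> \<union> c ` {\<tau>. \<tau> \<subset> \<sigma>} \<Longrightarrow>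
    \<rho> \<in> K \<or> \<rho> = {} \<Longrightarrow> insert (c \<sigma>) \<rho> \<in> K"
    and "finite \<C>" "\<C> \<noteq> {}" "\<And>A. A \<in> \<C> \<Longrightarrow> finite A \<and> A \<subseteq> \<Union>K \<and> \<tau> \<subseteq> A"
    and "\<And>A B. A \<in> \<C> \<Longrightarrow> B \<in> \<C> \<Longrightarrow> A \<subseteq> B \<or> B \<subseteq> A" "\<tau> \<in> K \<or> \<tau> = {}"
  shows "\<tau> \<union> c ` \<C> \<in> K"
  using assms(2-)
proof (induction \<C> rule: finite_psubset_induct)
  case (psubset \<C>)
  obtain A where A: "A \<in> \<C>" "\<And>B. B \<in> \<C> \<Longrightarrow> A \<subseteq> B \<Longrightarrow> A = B"
    using finite_has_maximal [OF psubset.hyps(1) psubset.prems(1)] by blast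
  then have max: "B \<subset> A" if "B \<in> \<C> - {A}" for B
    using that psubset.prems(3) by blast
  let ?\<rho> = "\<tau> \<union> c ` (\<C> - {A})"
  have "?\<rho> \<in> K \<or> ?\<rho> = {}"
  proof (cases "\<C> - {A} = {}")
    case True
    then show ?thesis using psubset.prems(4) by (simp add: True)
  next
    case False
    have "?\<rho> \<in> K"
    proof (rule psubset.IH)
      show "\<C> - {A} \<subset> \<C>" using A(1) by blast
      show "finite B \<and> B \<subseteq> \<Union>K \<and> \<tau> \<subseteq> B" if "B \<in> \<C> - {A}" for B
        using psubset.prems(2) that by simp
      show "B \<subseteq> B' \<or> B' \<subseteq> B" if "B \<in> \<C> - {A}" "B' \<in> \<C> - {A}" for B B'
        using psubset.prems(3) that by simp
    qed (fact False psubset.prems(4))+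
    then show ?thesis ..
  qed
  moreover have "?\<rho> \<subseteq> A \<union> c ` {\<tau>. \<tau> \<subset> A}"
  proof -
    have "c ` (\<C> - {A}) \<subseteq> c ` {\<tau>. \<tau> \<subset> A}" using max by (intro image_mono) blast
    then show ?thesis using psubset.prems(2) [OF A(1)] by blast
  qed
  ultimately have "insert (c A) ?\<rho> \<in> K"
    using c [of A ?\<rho>] psubset.prems(2) [OF A(1)] by simp
  moreover have "insert (c A) ?\<rho> = \<tau> \<union> c ` \<C>" using A(1) by blast
  ultimately show ?case by simp
qed

text \<open>Let \<open>K * w\<close> be the cone on \<open>K\<close>. Subdivide it at an interior point of every simplex
  \<open>\<sigma> \<union> {w}\<close>, in order of decreasing dimension: its simplices become \<open>\<tau>\<close> together with the new
  vertices of a chain \<open>\<sigma>\<^sub>0 \<subset> \<dots> \<subset> \<sigma>\<^sub>m\<close>, where \<open>\<tau> \<subseteq> \<sigma>\<^sub>0\<close>. Mapping the new vertex of \<open>\<sigma>\<close> to \<open>c \<sigma>\<close>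
  retracts the cone onto \<open>K\<close>.\<close>

theorem contractible_geometric_realization_if_cones:
  assumes K: "\<And>\<sigma>. \<sigma> \<in> K \<Longrightarrow> finite \<sigma>"
    and sub: "\<And>\<sigma> \<tau>. \<sigma> \<in> K \<Longrightarrow> \<tau> \<subseteq> \<sigma> \<Longrightarrow> \<tau> \<noteq> {} \<Longrightarrow> \<tau> \<in> K"
    and cone: "\<And>B. finite B \<Longrightarrow> B \<subseteq> \<Union>K \<Longrightarrow> \<exists>w. \<forall>\<rho>\<subseteq>B. \<rho> \<in> K \<or> \<rho> = {} \<longrightarrow> insert w \<rho> \<in> K"
  shows "contractible_nonempty (geometric_realization K)"
proof -
  obtain c where c: "\<And>\<sigma> \<rho>. finite \<sigma> \<Longrightarrow> \<sigma> \<subseteq> \<Union>K \<Longrightarrow> \<rho> \<subseteq> \<sigma> \<union> c ` {\<tau>. \<tau> \<subset> \<sigma>} \<Longrightarrow>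
      \<rho> \<in> K \<or> \<rho> = {} \<Longrightarrow> insert (c \<sigma>) \<rho> \<in> K"
    using exists_cone_vertices [of K] cone by blast
  let ?R = "geometric_realization K" and ?I = "top_of_set {0..1::real}"
  \<comment> \<open>Scaling by \<open>1 - s\<close> leaves weight \<open>s\<close> for the cone
    vertex.\<close>
  define sc where "sc s t = (\<lambda>v. (1 - s) * t v)" for s :: real and t :: "'a \<Rightarrow> real"
  \<comment> \<open>Taking the support of \<open>t\<close> gives a definition on the whole
    realization without choosing a simplex; \<open>h_eq\<close> passes to any simplex containing
    \<open>t\<close>.\<close>
  define h where "h = (\<lambda>(s, t) u. let S = {v. t v \<noteq> 0} in
      cone_weight c S s (sc s t) u / cone_total S s (sc s t))"
  have h_eq: "h (s, t) u = cone_weight c \<sigma> s (sc s t) u / cone_total \<sigma> s (sc s t)"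
    if "\<sigma> \<in> K" "t \<in> closed_simplex \<sigma>" "0 \<le> s" for s t u \<sigma>
  proof -
    let ?S = "{v. t v \<noteq> 0}"
    have "?S \<subseteq> \<sigma>" using closed_simplexD(2) [OF that(2)] by blast
    then show ?thesis
      unfolding h_def Let_def prod.case
      using cone_weight_cong [of \<sigma> ?S "sc s t" c s] cone_total_cong [of \<sigma> ?S "sc s t" s]
        K [OF that(1)] that(3) by (simp add: sc_def)
  qed
  have tot: "0 < cone_total \<sigma> s (sc s t)"
    if "\<sigma> \<in> K" "t \<in> closed_simplex \<sigma>" "0 \<le> s" for s t \<sigma>
  proof (rule cone_total_pos)
    show "0 < s \<or> (\<exists>v. s < sc s t v)"
    proof (cases "s = 0")
      case True
      have "\<exists>v. t v \<noteq> 0" using closed_simplexD(3) [OF that(2)] by (metis sum.neutral zero_neq_one)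
      then show ?thesis using True closed_simplexD(1) [OF that(2)] by (auto simp: sc_def less_le)
    qed (use that in auto)
  qed (use K that closed_simplexD(2) [OF that(2)] in \<open>auto simp: sc_def\<close>)
  have cont: "continuous_map (prod_topology ?I (subtopology (powertop_real UNIV) (closed_simplex \<sigma>))) ?R h"
    (is "continuous_map ?P _ _") if \<sigma>: "\<sigma> \<in> K" for \<sigma>
  proof (rule continuous_map_into_geometric_realization)
    \<comment> \<open>Over one closed simplex only the vertices in \<open>?B\<close> can receive
      weight, so the image lies in finitely many closed simplices.\<close>
    let ?B = "\<sigma> \<union> c ` Pow \<sigma>"
    let ?F = "{\<rho> \<in> K. \<rho> \<subseteq> ?B}"
    have fB: "finite ?B" using K [OF \<sigma>] by simp
    show "finite ?F"
      by (rule finite_subset [of _ "Pow ?B"]) (use fB in auto)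
    show "?F \<subseteq> K" by blast
    have top: "topspace ?P = {0..1} \<times> closed_simplex \<sigma>" by simp
    have fst: "continuous_map ?P euclideanreal fst"
      by (intro continuous_map_into_fulltopology [OF continuous_map_fst])
    have snd: "continuous_map ?P euclideanreal (\<lambda>z. snd z v)" for v
      using continuous_map_compose [OF continuous_map_snd continuous_map_closed_simplex_coordinate]
      by (simp add: o_def)
    have sc: "continuous_map ?P euclideanreal (\<lambda>z. sc (fst z) (snd z) v)" for v
      unfolding sc_def by (intro continuous_intros fst snd)
    have sc0: "sc (fst z) (snd z) v = 0" if "z \<in> topspace ?P" "v \<notin> \<sigma>" for z v
    proof -
      have "snd z \<in> closed_simplex \<sigma>" using that(1) by (cases z) simp
      then have "snd z v = 0" using that(2) by (rule closed_simplexD(2))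
      then show ?thesis by (simp add: sc_def)
    qed
    have lw: "continuous_map ?P euclideanreal (\<lambda>z. level_weight \<tau> (fst z) (sc (fst z) (snd z)))"
      if "\<tau> \<subseteq> \<sigma>" for \<tau>
      using K [OF \<sigma>] sc sc0 fst that
      by (intro continuous_map_level_weight [where S = \<sigma> and t = "\<lambda>z. sc (fst z) (snd z)" and w = fst])
    have cw: "continuous_map ?P euclideanreal (\<lambda>z. cone_weight c \<sigma> (fst z) (sc (fst z) (snd z)) u)" for u
    proof -
      have "continuous_map ?P euclideanreal
          (\<lambda>z. if c \<tau> = u then level_weight \<tau> (fst z) (sc (fst z) (snd z)) else 0)" if "\<tau> \<in> Pow \<sigma>" for \<tau>
        using lw that by (cases "c \<tau> = u") auto
      then show ?thesis
        unfolding cone_weight_def using K [OF \<sigma>]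
        by (intro continuous_map_add continuous_map_real_max continuous_map_diff continuous_map_sum
            sc fst continuous_map_const [THEN iffD2]) auto
    qed
    have ct: "continuous_map ?P euclideanreal (\<lambda>z. cone_total \<sigma> (fst z) (sc (fst z) (snd z)))"
      unfolding cone_total_def using K [OF \<sigma>] lw
      by (intro continuous_map_add continuous_map_real_max continuous_map_diff continuous_map_sum
          sc fst continuous_map_const [THEN iffD2]) auto
    show "continuous_map ?P (powertop_real UNIV) h"
      unfolding continuous_map_componentwise_UNIV
    proof
      fix u
      show "continuous_map ?P euclideanreal (\<lambda>z. h z u)"
      proof (rule continuous_map_eq)
        show "continuous_map ?P euclideanreal (\<lambda>z. cone_weight c \<sigma> (fst z) (sc (fst z) (snd z)) u
            / cone_total \<sigma> (fst z) (sc (fst z) (snd z)))"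
          by (intro continuous_map_real_divide cw ct) (use tot [OF \<sigma>] top in \<open>force simp: less_le\<close>)
        show "cone_weight c \<sigma> (fst z) (sc (fst z) (snd z)) u / cone_total \<sigma> (fst z) (sc (fst z) (snd z)) = h z u"
          if "z \<in> topspace ?P" for z
          using h_eq [OF \<sigma>] that by (cases z) auto
      qed
    qed
    show "h \<in> topspace ?P \<rightarrow> (\<Union>\<rho>\<in>?F. closed_simplex \<rho>)"
    proof
      fix z assume "z \<in> topspace ?P"
      then obtain s t where z: "z = (s, t)" and s: "0 \<le> s" "s \<le> 1" and t: "t \<in> closed_simplex \<sigma>"
        by (cases z) auto
      let ?t = "sc s t"
      have t0: "?t v = 0" if "v \<notin> \<sigma>" for v
        using that closed_simplexD(2) [OF t] by (simp add: sc_def)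
      \<comment> \<open>The superlevel sets occurring below height \<open>s\<close> form a chain,
        and all of them contain the set \<open>\<tau>\<close> of vertices above \<open>s\<close>: a
        simplex of the subdivided cone.\<close>
      define \<C> where "\<C> = {\<tau> \<in> Pow \<sigma>. 0 < level_weight \<tau> s ?t}"
      define \<tau> where "\<tau> = {u. s < ?t u}"
      define Z where "Z = \<tau> \<union> c ` \<C>"
      have \<tau>: "\<tau> \<subseteq> \<sigma>" using t0 s unfolding \<tau>_def by force
      have \<tau>K: "\<tau> \<in> K \<or> \<tau> = {}" using sub [OF \<sigma> \<tau>] by blast
      have lwp: "(\<forall>v\<in>-A. ?t v < s \<and> (\<forall>u\<in>A. ?t v < ?t u))" if "A \<in> \<C>" for A
      proof -
        have A: "A \<subseteq> \<sigma>" "0 < level_weight A s ?t" using that by (auto simp: \<C>_def)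
        have "finite A" using A(1) K [OF \<sigma>] by (rule finite_subset)
        then show ?thesis
          using level_weight_pos_iff [of \<sigma> ?t A s] K [OF \<sigma>] t0 A(2) by blast
      qed
      have ch: "A \<subseteq> B \<or> B \<subseteq> A" if "A \<in> \<C>" "B \<in> \<C>" for A B
      proof (rule ccontr)
        assume "\<not> (A \<subseteq> B \<or> B \<subseteq> A)"
        then obtain u v where "u \<in> A" "u \<notin> B" "v \<in> B" "v \<notin> A" by blast
        then have "?t v < ?t u" "?t u < ?t v" using lwp that by blast+
        then show False by simp
      qed
      have \<tau>A: "\<tau> \<subseteq> A" if "A \<in> \<C>" for A
        
      proof
        fix u assume "u \<in> \<tau>"
        then have "\<not> ?t u < s" by (simp add: \<tau>_def)
        then show "u \<in> A" using lwp [OF that] by blast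
      qed
      have ZK: "Z \<in> K"
      proof (cases "\<C> = {}")
        \<comment> \<open>Nothing is assigned to cone vertices, so the positive total comes from
          vertices above \<open>s\<close>, and \<open>\<tau>\<close> is nonempty.\<close>
        case True
        then have "(\<Sum>\<sigma>'\<in>Pow \<sigma>. level_weight \<sigma>' s ?t) = 0"
          unfolding \<C>_def by (intro sum.neutral) (auto simp: less_le)
        then have "0 < (\<Sum>u\<in>\<sigma>. max 0 (?t u - s))"
          using tot [OF \<sigma> t s(1)] by (simp add: cone_total_def)
        then obtain u where "max 0 (?t u - s) \<noteq> 0"
          by (metis less_irrefl sum.neutral)
        then have "u \<in> \<tau>" by (simp add: \<tau>_def max_def split: if_splits)
        then have "\<tau> \<noteq> {}" by blast
        then show ?thesis using True \<tau>K by (simp add: Z_def)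
      next
        case False
        show ?thesis unfolding Z_def
        proof (rule cone_vertices_chain)
          show "insert (c A) \<rho> \<in> K" if "finite A" "A \<subseteq> \<Union>K" "\<rho> \<subseteq> A \<union> c ` {\<tau>. \<tau> \<subset> A}"
            "\<rho> \<in> K \<or> \<rho> = {}" for A \<rho>
            using that by (rule c)
          show "finite \<C>" unfolding \<C>_def using K [OF \<sigma>] by simp
          show "finite A \<and> A \<subseteq> \<Union>K \<and> \<tau> \<subseteq> A" if "A \<in> \<C>" for A
          proof (intro conjI)
            have "A \<subseteq> \<sigma>" using that by (simp add: \<C>_def)
            then show "finite A" "A \<subseteq> \<Union>K" using K [OF \<sigma>] \<sigma> by (auto intro: finite_subset)
          qed (rule \<tau>A [OF that])
        qed (fact ch \<tau>K False)+
      qed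
      have "Z \<subseteq> ?B" using \<tau> by (auto simp: Z_def \<C>_def)
      have hz: "h z u = cone_weight c \<sigma> s ?t u / cone_total \<sigma> s ?t" for u
        using h_eq [OF \<sigma> t s(1)] z by simp
      have out: "cone_weight c \<sigma> s ?t u = 0" if "u \<notin> Z" for u
      proof (rule ccontr)
        assume "cone_weight c \<sigma> s ?t u \<noteq> 0"
        then have "0 < cone_weight c \<sigma> s ?t u"
          using cone_weight_nonneg [of c \<sigma> s ?t u] by simp
        then have "u \<in> Z"
          using cone_weight_support [OF K [OF \<sigma>], of c s ?t u] by (simp add: Z_def \<tau>_def \<C>_def)
        then show False using that by simp
      qed
      have "(\<Sum>u\<in>Z. cone_weight c \<sigma> s ?t u) = (\<Sum>u\<in>?B. cone_weight c \<sigma> s ?t u)"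
        using fB \<open>Z \<subseteq> ?B\<close> out by (intro sum.mono_neutral_left) auto
      also have "\<dots> = cone_total \<sigma> s ?t"
        using fB t0 s(1) by (intro sum_cone_weight) auto
      finally have sum: "(\<Sum>u\<in>Z. cone_weight c \<sigma> s ?t u) = cone_total \<sigma> s ?t" .
      have "h z \<in> closed_simplex Z"
        unfolding closed_simplex_def
      proof (intro CollectI conjI allI impI)
        show "0 \<le> h z u" for u
          unfolding hz using tot [OF \<sigma> t s(1)] by (intro divide_nonneg_pos cone_weight_nonneg)
        show "h z u = 0" if "u \<notin> Z" for u
          using out [OF that] by (simp add: hz)
        have "(\<Sum>u\<in>Z. h z u) = (\<Sum>u\<in>Z. cone_weight c \<sigma> s ?t u) / cone_total \<sigma> s ?t"
          unfolding hz by (rule sum_divide_distrib [symmetric])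
        then show "(\<Sum>u\<in>Z. h z u) = 1"
          using tot [OF \<sigma> t s(1)] sum by simp
      qed
      then show "h z \<in> (\<Union>\<rho>\<in>?F. closed_simplex \<rho>)" using ZK \<open>Z \<subseteq> ?B\<close> by blast
    qed
  qed
  have "continuous_map (prod_topology ?I ?R) ?R h"
    by (rule continuous_map_interval_geometric_realization) (rule cont)
  moreover have "h (0, t) = t \<and> h (1, t) = (\<lambda>u. if u = c {} then 1 else 0)" if tR: "t \<in> topspace ?R" for t
  proof -
    obtain \<sigma> where \<sigma>: "\<sigma> \<in> K" and t: "t \<in> closed_simplex \<sigma>"
      using tR by (auto simp: topspace_geometric_realization)
    note [simp] = K [OF \<sigma>]
    have lw0: "level_weight \<tau> 0 t = 0" if "\<tau> \<in> Pow \<sigma>" for \<tau>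
    proof -
      have "finite \<tau>" using that K [OF \<sigma>] by (auto intro: finite_subset)
      then have "\<not> 0 < level_weight \<tau> 0 t"
        using level_weight_pos_iff [of \<sigma> t \<tau> 0] closed_simplexD(2) [OF t] by simp
      then show ?thesis using level_weight_nonneg [of \<tau> 0 t] by linarith
    qed
    have "h (0, t) u = t u" for u
      using closed_simplexD(1,3) [OF t] lw0
      by (simp add: h_eq [OF \<sigma> t] sc_def cone_weight_def cone_total_def sum.neutral cong: sum.cong if_cong)
    \<comment> \<open>At \<open>s = 1\<close> the scaled point is 0, and the superlevel set is empty
      at every height; the homotopy ends at the vertex \<open>c {}\<close>.\<close>
    moreover have lw1: "level_weight \<tau> 1 (\<lambda>v. 0) = (if \<tau> = {} then 1 else 0)" if "\<tau> \<in> Pow \<sigma>" for \<tau> :: "'a set"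
    proof -
      have "(\<lambda>v. 0) ` A = (if A = {} then {} else {0::real})" for A :: "'a set" by auto
      then show ?thesis by (auto simp: level_weight_def sup_on_def)
    qed
    have "h (1, t) u = (if u = c {} then 1 else 0)" for u
    proof -
      have "(\<Sum>\<tau>\<in>Pow \<sigma>. if c \<tau> = u then level_weight \<tau> 1 (\<lambda>v. 0) else 0)
          = (\<Sum>\<tau>\<in>Pow \<sigma>. if \<tau> = {} then if c {} = u then 1 else 0 else 0)"
        using lw1 by (intro sum.cong) auto
      moreover have "(\<Sum>\<tau>\<in>Pow \<sigma>. level_weight \<tau> 1 (\<lambda>v::'a. 0)) = (\<Sum>\<tau>\<in>Pow \<sigma>. if \<tau> = {} then 1 else 0)"
        using lw1 by (intro sum.cong) auto
      ultimately show ?thesis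
        by (auto simp: h_eq [OF \<sigma> t] sc_def cone_weight_def cone_total_def)
    qed
    ultimately show ?thesis by blast
  qed
  ultimately have "homotopic_with (\<lambda>h. True) ?R ?R id (\<lambda>t. (\<lambda>u. if u = c {} then 1 else 0))"
    by (subst homotopic_with) (auto intro!: exI [of _ h])
  moreover have "topspace ?R \<noteq> {}"
  proof -
    have "{c {}} \<in> K" using c [of "{}" "{}"] by simp
    moreover have "(\<lambda>u. if u = c {} then 1 else 0) \<in> closed_simplex {c {}}"
      by (simp add: closed_simplex_def)
    ultimately show ?thesis by (auto simp: topspace_geometric_realization)
  qed
  ultimately show ?thesis
    unfolding contractible_nonempty_def contractible_space_def by blast
qed

section \<open>Normal subgroups of finite index\<close>

context group
begin

lemma rcosets_Int:
  assumes "subgroup A G" "subgroup B G" "x \<in> carrier G"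
  shows "(A \<inter> B) #> x = (A #> x) \<inter> (B #> x)"
proof -
  have "a \<in> B" if "a \<in> A" "b \<in> B" "a \<otimes> x = b \<otimes> x" for a b
    using that assms by (metis right_cancel subgroup.mem_carrier)
  then show ?thesis unfolding r_coset_def by fastforce
qed

lemma finite_index_Int:
  assumes "subgroup A G" "subgroup B G" "finite_index G A" "finite_index G B"
  shows "finite_index G (A \<inter> B)"
proof -
  have "(rcosets (A \<inter> B)) \<subseteq> (\<lambda>(C, D). C \<inter> D) ` ((rcosets A) \<times> (rcosets B))"
    using rcosets_Int [OF assms(1,2)] by (force simp: RCOSETS_def)
  moreover have "finite ((rcosets A) \<times> (rcosets B))"
    using assms by (simp add: finite_index_def)
  ultimately show ?thesis
    unfolding finite_index_def by (meson finite_imageI finite_subset)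
qed

lemma finite_index_carrier: "finite_index G (carrier G)"
proof -
  have "rcosets (carrier G) \<subseteq> {carrier G}"
    using coset_join2 [OF _ subgroup_self] by (auto simp: RCOSETS_def)
  then show ?thesis unfolding finite_index_def by (rule finite_subset) simp
qed

lemma finite_index_mono:
  assumes "subgroup N G" "subgroup H G" "N \<subseteq> H" "finite_index G N"
  shows "finite_index G H"
proof -
  have "(rcosets H) \<subseteq> (\<lambda>C. H #> (SOME y. y \<in> C)) ` (rcosets N)"
  proof
    fix D assume "D \<in> rcosets H"
    then obtain x where x: "x \<in> carrier G" and D: "D = H #> x"
      by (auto simp: RCOSETS_def)
    have "(SOME y. y \<in> N #> x) \<in> N #> x"
      using rcos_self [OF x assms(1)] by (rule someI)
    then have "(SOME y. y \<in> N #> x) \<in> H #> x"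
      using assms(3) by (auto simp: r_coset_def)
    then have "D = H #> (SOME y. y \<in> N #> x)"
      unfolding D using repr_independence x assms(2) by blast
    moreover have "N #> x \<in> rcosets N"
      using x by (auto simp: RCOSETS_def)
    ultimately show "D \<in> (\<lambda>C. H #> (SOME y. y \<in> C)) ` (rcosets N)" by blast
  qed
  then show ?thesis
    using assms(4) finite_surj unfolding finite_index_def by blast
qed

text \<open>An overgroup of \<open>N\<close> is a union of cosets of \<open>N\<close>, and there are
  finitely many of these.\<close>

lemma finite_overgroups:
  assumes "subgroup N G" "finite_index G N"
  shows "finite {H. subgroup H G \<and> N \<subseteq> H}"
proof (rule finite_surj [of "Pow (rcosets N)" _ Union])
  show "finite (Pow (rcosets N))" using assms(2) by (simp add: finite_index_def)
  show "{H. subgroup H G \<and> N \<subseteq> H} \<subseteq> \<Union> ` Pow (rcosets N)"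
  proof
    fix H assume "H \<in> {H. subgroup H G \<and> N \<subseteq> H}"
    then have H: "subgroup H G" "N \<subseteq> H" by simp_all
    have "H = \<Union> {C \<in> rcosets N. C \<subseteq> H}"
    proof
      show "H \<subseteq> \<Union> {C \<in> rcosets N. C \<subseteq> H}"
      proof
        fix x assume x: "x \<in> H"
        then have xG: "x \<in> carrier G" by (rule subgroup.mem_carrier [OF H(1)])
        have "N #> x \<subseteq> H" using subgroup.m_closed [OF H(1) _ x] H(2) unfolding r_coset_def by blast
        moreover have "x \<in> N #> x" using rcos_self [OF xG assms(1)] .
        moreover have "N #> x \<in> rcosets N" using xG by (auto simp: RCOSETS_def)
        ultimately show "x \<in> \<Union> {C \<in> rcosets N. C \<subseteq> H}" by blast
      qed
    qed blast
    then show "H \<in> \<Union> ` Pow (rcosets N)" by blast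
  qed
qed

text \<open>The normal core arises as the kernel of the action on the right cosets.\<close>

lemma exists_normal_core:
  assumes H: "subgroup H G" "finite_index G H"
  shows "\<exists>N. N \<lhd> G \<and> finite_index G N \<and> N \<subseteq> H"
proof (intro exI conjI)
  define N where "N = {x \<in> carrier G. \<forall>C\<in>rcosets H. C #> x = C}"
  have car: "C \<subseteq> carrier G" if "C \<in> rcosets H" for C
    using that H(1) subgroup.rcosets_carrier is_group by blast
  have act: "C #> x \<in> rcosets H" if "C \<in> rcosets H" "x \<in> carrier G" for C x
    using that H(1) subgroup.subset [OF H(1)] by (auto simp: RCOSETS_def coset_mult_assoc)
  have mult: "C #> x #> y = C #> (x \<otimes> y)" if "C \<in> rcosets H" "x \<in> carrier G" "y \<in> carrier G" for C x y
    using coset_mult_assoc car that by blast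
  have inv: "C #> inv x = C" if "x \<in> N" "C \<in> rcosets H" for x C
  proof -
    have x: "x \<in> carrier G" "C #> x = C" using that by (auto simp: N_def)
    have "C #> inv x = C #> x #> inv x" using x by simp
    also have "\<dots> = C" using mult [OF that(2) x(1) inv_closed] x(1) car [OF that(2)] by simp
    finally show ?thesis .
  qed
  show "N \<lhd> G"
    unfolding normal_inv_iff
  proof (intro conjI ballI)
    show "subgroup N G"
    proof (rule subgroupI)
      have "\<one> \<in> N" using car by (simp add: N_def)
      then show "N \<noteq> {}" by blast
      show "inv x \<in> N" if "x \<in> N" for x using that inv by (simp add: N_def)
      show "x \<otimes> y \<in> N" if "x \<in> N" "y \<in> N" for x y
      proof -
        have "C #> (x \<otimes> y) = C" if "C \<in> rcosets H" for C
          using mult [OF that, of x y, symmetric] \<open>x \<in> N\<close> \<open>y \<in> N\<close> that by (simp add: N_def)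
        then show ?thesis using that by (simp add: N_def)
      qed
    qed (auto simp: N_def)
    fix g x assume g: "g \<in> carrier G" and x: "x \<in> N"
    have xG: "x \<in> carrier G" using x by (simp add: N_def)
    have "C #> (g \<otimes> x \<otimes> inv g) = C" if C: "C \<in> rcosets H" for C
    proof -
      have "C #> (g \<otimes> x \<otimes> inv g) = C #> g #> x #> inv g"
        using g xG by (simp add: mult act C m_assoc)
      also have "\<dots> = C #> g #> inv g" using x act [OF C g] by (simp add: N_def)
      also have "\<dots> = C" using mult [OF C g inv_closed] g car [OF C] by simp
      finally show ?thesis .
    qed
    then show "g \<otimes> x \<otimes> inv g \<in> N" using g xG by (simp add: N_def)
  qed
  show "N \<subseteq> H"
  proof
    fix x assume x: "x \<in> N"
    have "H \<in> rcosets H" using subgroup.subgroup_in_rcosets [OF H(1) is_group] .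
    then have "H #> x = H" using x by (simp add: N_def)
    then show "x \<in> H" using coset_join1 [OF _ _ H(1)] x subgroup.subset [OF H(1)] by (simp add: N_def)
  qed
  show "finite_index G N"
    unfolding finite_index_def
  \<comment> \<open>A coset \<open>N #> x\<close> is determined by the map that \<open>x\<close>
    induces on the finite set of cosets of \<open>H\<close>.\<close>
  proof (rule finite_surj [of "rcosets H \<rightarrow>\<^sub>E rcosets H" _
        "\<lambda>f. {y \<in> carrier G. \<forall>C\<in>rcosets H. C #> y = f C}"])
    show "finite (rcosets H \<rightarrow>\<^sub>E rcosets H)"
      using H(2) by (intro finite_PiE) (auto simp: finite_index_def)
    show "(rcosets N) \<subseteq> (\<lambda>f. {y \<in> carrier G. \<forall>C\<in>rcosets H. C #> y = f C}) ` (rcosets H \<rightarrow>\<^sub>E rcosets H)"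
    proof
      fix D assume "D \<in> rcosets N"
      then obtain x where x: "x \<in> carrier G" and D: "D = N #> x"
        by (auto simp: RCOSETS_def)
      have "D = {y \<in> carrier G. \<forall>C\<in>rcosets H. C #> y = C #> x}"
      proof
        show "D \<subseteq> {y \<in> carrier G. \<forall>C\<in>rcosets H. C #> y = C #> x}"
        proof
          fix y assume "y \<in> D"
          then obtain n where n: "n \<in> N" "y = n \<otimes> x" by (auto simp: D r_coset_def)
          then have "n \<in> carrier G" by (simp add: N_def)
          then show "y \<in> {y \<in> carrier G. \<forall>C\<in>rcosets H. C #> y = C #> x}"
            using n x mult [symmetric] by (simp add: N_def)
        qed
        show "{y \<in> carrier G. \<forall>C\<in>rcosets H. C #> y = C #> x} \<subseteq> D"
        proof
          fix y assume y: "y \<in> {y \<in> carrier G. \<forall>C\<in>rcosets H. C #> y = C #> x}"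
          have "C #> (y \<otimes> inv x) = C" if C: "C \<in> rcosets H" for C
          proof -
            have "C #> (y \<otimes> inv x) = C #> y #> inv x" using y mult [OF C _ inv_closed [OF x], of y] by simp
            also have "\<dots> = C #> x #> inv x" using y C by simp
            also have "\<dots> = C" using mult [OF C x inv_closed] x car [OF C] by simp
            finally show ?thesis .
          qed
          then have "y \<otimes> inv x \<in> N" using x y by (simp add: N_def)
          moreover have "y = y \<otimes> inv x \<otimes> x" using x y by (simp add: m_assoc)
          ultimately show "y \<in> D" unfolding D r_coset_def by blast
        qed
      qed
      moreover have "(\<lambda>C\<in>rcosets H. C #> x) \<in> rcosets H \<rightarrow>\<^sub>E rcosets H"
        using act x by auto
      moreover have "{y \<in> carrier G. \<forall>C\<in>rcosets H. C #> y = C #> x}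
          = {y \<in> carrier G. \<forall>C\<in>rcosets H. C #> y = (\<lambda>C\<in>rcosets H. C #> x) C}"
        by auto
      ultimately show "D \<in> (\<lambda>f. {y \<in> carrier G. \<forall>C\<in>rcosets H. C #> y = f C}) ` (rcosets H \<rightarrow>\<^sub>E rcosets H)"
        by blast
    qed
  qed
qed

lemma subset_set_mult:
  assumes "subgroup A G" "subgroup B G"
  shows "A \<subseteq> A <#> B" "B \<subseteq> A <#> B"
proof -
  have "a \<otimes> \<one> \<in> A <#> B" if "a \<in> A" for a
    using that assms subgroup.one_closed unfolding set_mult_def by blast
  then show "A \<subseteq> A <#> B" using subgroup.mem_carrier [OF assms(1)] by force
  have "\<one> \<otimes> b \<in> A <#> B" if "b \<in> B" for b
    using that assms subgroup.one_closed unfolding set_mult_def by blast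
  then show "B \<subseteq> A <#> B" using subgroup.mem_carrier [OF assms(2)] by force
qed

lemma normal_set_mult:
  assumes "A \<lhd> G" "B \<lhd> G"
  shows "A <#> B \<lhd> G"
  unfolding normal_inv_iff
proof (intro conjI ballI)
  show "subgroup (A <#> B) G"
    by (rule mult_norm_subgroup [OF assms(1) normal_imp_subgroup [OF assms(2)]])
  fix g x assume g: "g \<in> carrier G" and "x \<in> A <#> B"
  then obtain a b where ab: "a \<in> A" "b \<in> B" "x = a \<otimes> b" unfolding set_mult_def by blast
  have car: "a \<in> carrier G" "b \<in> carrier G"
    using ab subgroup.mem_carrier [OF normal_imp_subgroup [OF assms(1)]]
      subgroup.mem_carrier [OF normal_imp_subgroup [OF assms(2)]] by auto
  have "g \<otimes> x \<otimes> inv g = (g \<otimes> a \<otimes> inv g) \<otimes> (g \<otimes> b \<otimes> inv g)"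
  proof -
    have "inv g \<otimes> (g \<otimes> (b \<otimes> inv g)) = b \<otimes> inv g"
      using g car by (simp flip: m_assoc)
    then show ?thesis using g car ab(3) by (simp add: m_assoc)
  qed
  moreover have "g \<otimes> a \<otimes> inv g \<in> A" "g \<otimes> b \<otimes> inv g \<in> B"
    using normal.inv_op_closed2 [OF assms(1) g ab(1)] normal.inv_op_closed2 [OF assms(2) g ab(2)] .
  ultimately show "g \<otimes> x \<otimes> inv g \<in> A <#> B" unfolding set_mult_def by blast
qed

lemma proper_normal_fiD:
  assumes "N \<in> proper_normal_fi G"
  shows "N \<lhd> G" "subgroup N G" "N \<noteq> carrier G" "finite_index G N" "\<one> \<in> N" "N \<subseteq> carrier G"
proof -
  show N: "N \<lhd> G" "N \<noteq> carrier G" "finite_index G N"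
    using assms by (simp_all add: proper_normal_fi_def)
  then show sub: "subgroup N G" by (intro normal_imp_subgroup)
  show "\<one> \<in> N" "N \<subseteq> carrier G"
    using subgroup.one_closed [OF sub] subgroup.subset [OF sub] .
qed

text \<open>\<open>W <#> M\<close> is normal, of finite index and contains \<open>M\<close>, so if
  it were proper, maximality would give \<open>W <#> M = M\<close>. All transversality of cosets
  below comes from this.\<close>

lemma maximal_set_mult_carrier:
  assumes M: "M \<in> maximal_elements (proper_normal_fi G)" and W: "W \<lhd> G" "\<not> W \<subseteq> M"
  shows "W <#> M = carrier G"
proof (rule ccontr)
  assume ne: "W <#> M \<noteq> carrier G"
  have M': "M \<in> proper_normal_fi G" using M by (simp add: maximal_elements_def)
  note sub = subset_set_mult [OF normal_imp_subgroup [OF W(1)] proper_normal_fiD(2) [OF M']]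
  have norm: "W <#> M \<lhd> G" by (rule normal_set_mult [OF W(1) proper_normal_fiD(1) [OF M']])
  have "finite_index G (W <#> M)"
    by (rule finite_index_mono [OF proper_normal_fiD(2) [OF M'] normal_imp_subgroup [OF norm] sub(2)
          proper_normal_fiD(4) [OF M']])
  then have "W <#> M \<in> proper_normal_fi G" using norm ne by (simp add: proper_normal_fi_def)
  then have "W <#> M = M" using M sub(2) by (simp add: maximal_elements_def)
  then show False using sub(1) W(2) by simp
qed

lemma exists_maximal_above:
  assumes N: "N \<in> proper_normal_fi G"
  shows "\<exists>M\<in>maximal_elements (proper_normal_fi G). N \<subseteq> M"
proof -
  let ?A = "{M \<in> proper_normal_fi G. N \<subseteq> M}"
  have "finite ?A"
    by (rule finite_subset [OF _ finite_overgroups [OF proper_normal_fiD(2,4) [OF N]]])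
      (use proper_normal_fiD(2) in blast)
  moreover have "?A \<noteq> {}" using N by blast
  ultimately obtain M where M: "M \<in> ?A" "\<And>B. B \<in> ?A \<Longrightarrow> M \<subseteq> B \<Longrightarrow> M = B"
    using finite_has_maximal by meson
  then show ?thesis unfolding maximal_elements_def by blast
qed

lemma infinite_maximal_not_above:
  assumes "infinite (maximal_elements (proper_normal_fi G))" "subgroup N G" "finite_index G N"
  shows "infinite {M \<in> maximal_elements (proper_normal_fi G). \<not> N \<subseteq> M}"
proof
  assume "finite {M \<in> maximal_elements (proper_normal_fi G). \<not> N \<subseteq> M}"
  moreover have "maximal_elements (proper_normal_fi G) \<subseteq>
      {M \<in> maximal_elements (proper_normal_fi G). \<not> N \<subseteq> M} \<union> {H. subgroup H G \<and> N \<subseteq> H}"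
    using proper_normal_fiD(2) by (auto simp: maximal_elements_def)
  ultimately show False
    using assms(1) finite_overgroups [OF assms(2,3)] by (meson finite_UnI finite_subset)
qed

text \<open>Maximal elements are transversal to normal subgroups only, so \<open>H\<close> is
  replaced by a normal \<open>N \<subseteq> H\<close> of finite index; a complement of
  \<open>N\<close> is one of \<open>H\<close>.\<close>

lemma infinite_complements:
  assumes inf: "infinite (maximal_elements (proper_normal_fi G))"
    and H: "subgroup H G" "finite_index G H"
  shows "infinite {M. is_complement G H M \<and> M \<lhd> G \<and> finite_index G M}"
proof -
  obtain N where N: "N \<lhd> G" "finite_index G N" "N \<subseteq> H"
    using exists_normal_core [OF H] by blast
  have "{M \<in> maximal_elements (proper_normal_fi G). \<not> N \<subseteq> M} \<subseteq>
      {M. is_complement G H M \<and> M \<lhd> G \<and> finite_index G M}"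
  proof
    fix M assume M: "M \<in> {M \<in> maximal_elements (proper_normal_fi G). \<not> N \<subseteq> M}"
    then have M': "M \<in> proper_normal_fi G" by (simp add: maximal_elements_def)
    have "carrier G = N <#> M" using maximal_set_mult_carrier [OF _ N(1)] M by simp
    moreover have "N <#> M \<subseteq> H <#> M" by (rule mono_set_mult [OF N(3) order_refl])
    moreover have "H <#> M \<subseteq> carrier G"
      by (rule setmult_subset_G [OF subgroup.subset [OF H(1)] proper_normal_fiD(6) [OF M']])
    ultimately have "carrier G = H <#> M" by blast
    then show "M \<in> {M. is_complement G H M \<and> M \<lhd> G \<and> finite_index G M}"
      using proper_normal_fiD [OF M'] by (simp add: is_complement_def)
  qed
  then show ?thesis
    using infinite_maximal_not_above [OF inf normal_imp_subgroup [OF N(1)] N(2)] finite_subset by blast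
qed

text \<open>The factor \<open>carrier G\<close> makes the empty family yield the whole group instead
  of \<open>UNIV\<close>.\<close>

lemma normal_fi_Inter:
  assumes "finite \<M>" "\<And>M. M \<in> \<M> \<Longrightarrow> M \<lhd> G \<and> finite_index G M"
  shows "carrier G \<inter> \<Inter>\<M> \<lhd> G \<and> finite_index G (carrier G \<inter> \<Inter>\<M>)"
  using assms
proof (induction \<M>)
  case empty
  have "carrier G \<lhd> G" by (simp add: normal_inv_iff subgroup_self)
  then show ?case by (simp add: finite_index_carrier)
next
  case (insert M \<M>)
  have "carrier G \<inter> \<Inter>(insert M \<M>) = M \<inter> (carrier G \<inter> \<Inter>\<M>)" by blast
  moreover have M: "M \<lhd> G" "finite_index G M" using insert.prems by auto
  moreover have \<M>: "carrier G \<inter> \<Inter>\<M> \<lhd> G" "finite_index G (carrier G \<inter> \<Inter>\<M>)"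
    using insert by auto
  ultimately show ?case
    using normal_subgroup_intersect [OF M(1) \<M>(1)]
      finite_index_Int [OF normal_imp_subgroup [OF M(1)] normal_imp_subgroup [OF \<M>(1)] M(2) \<M>(2)]
    by simp
qed

text \<open>A finite set of maximal elements has an intersection \<open>N\<close> that is normal of
  finite index. A complement \<open>C\<close> of \<open>N\<close> lies below some maximal
  \<open>M\<close>, and so does \<open>N\<close>; hence \<open>N <#> C\<close> is contained in
  \<open>M\<close> and cannot be the whole group.\<close>

lemma infinite_maximal_if_complements:
  assumes ne: "proper_normal_fi G \<noteq> {}"
    and compl: "\<And>N. N \<in> proper_normal_fi G \<Longrightarrow> \<exists>M. is_complement G N M \<and> M \<lhd> G \<and> finite_index G M"
  shows "infinite (maximal_elements (proper_normal_fi G))"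
proof
  let ?X = "maximal_elements (proper_normal_fi G)"
  assume fin: "finite ?X"
  define N where "N = carrier G \<inter> \<Inter>?X"
  have NX: "N \<subseteq> M" if "M \<in> ?X" for M using that by (auto simp: N_def)
  have X: "M \<in> proper_normal_fi G" if "M \<in> ?X" for M using that by (simp add: maximal_elements_def)
  have "N \<lhd> G \<and> finite_index G N"
    unfolding N_def using fin X by (intro normal_fi_Inter) (auto dest: proper_normal_fiD(1,4))
  \<comment> \<open>Without a maximal element the intersection \<open>N\<close> would be the whole
    group.\<close>
  moreover obtain M0 where "M0 \<in> ?X" using ne exists_maximal_above by blast
  then have "N \<noteq> carrier G" using NX X proper_normal_fiD(3,6) by blast
  ultimately have "N \<in> proper_normal_fi G" by (simp add: proper_normal_fi_def)
  then obtain C where C: "is_complement G N C" "C \<lhd> G" "finite_index G C"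
    using compl by blast
  then have "C \<in> proper_normal_fi G" unfolding proper_normal_fi_def is_complement_def by blast
  then obtain M where M: "M \<in> ?X" "C \<subseteq> M" using exists_maximal_above by blast
  have "carrier G = N <#> C" using C(1) by (simp add: is_complement_def)
  also have "\<dots> \<subseteq> M <#> M" using NX [OF M(1)] M(2) by (rule mono_set_mult)
  also have "\<dots> = M" by (rule subgroup_mult_id [OF proper_normal_fiD(2) [OF X [OF M(1)]]])
  finally show False using proper_normal_fiD(3,6) [OF X [OF M(1)]] by blast
qed

section \<open>Infinitely many maximal elements\<close>

lemma coset_nerve_iff:
  "\<sigma> \<in> coset_nerve G \<K> \<longleftrightarrow> finite \<sigma> \<and> \<sigma> \<noteq> {} \<and> \<sigma> \<subseteq> left_cosets G \<K> \<and> (\<exists>x. \<forall>C\<in>\<sigma>. x \<in> C)"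
  by (auto simp: coset_nerve_def)

lemma l_coset_mult_closed:
  assumes "subgroup H G" "g \<in> carrier G" "x \<in> g <# H" "h \<in> H"
  shows "x \<otimes> h \<in> g <# H"
proof -
  obtain h' where h': "h' \<in> H" "x = g \<otimes> h'" using assms(3) by (auto simp: l_coset_def)
  then have "x \<otimes> h = g \<otimes> (h' \<otimes> h)"
    using assms subgroup.mem_carrier [OF assms(1)] by (simp add: m_assoc)
  moreover have "h' \<otimes> h \<in> H" using h' assms(4) subgroup.m_closed [OF assms(1)] by blast
  ultimately show ?thesis by (auto simp: l_coset_def)
qed

lemma l_coset_one_mem_iff:
  assumes "subgroup H G" "g \<in> carrier G"
  shows "\<one> \<in> g <# H \<longleftrightarrow> g \<in> H" and "\<one> \<in> g <# H \<Longrightarrow> g <# H = H"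
proof -
  show eq: "g <# H = H" if "\<one> \<in> g <# H"
    using l_repr_independence [OF that assms(2,1)] lcos_mult_one [OF subgroup.subset [OF assms(1)]] by simp
  show "\<one> \<in> g <# H \<longleftrightarrow> g \<in> H"
  proof
    assume "\<one> \<in> g <# H"
    then show "g \<in> H" using eq lcos_self [OF assms(2,1)] by simp
  next
    assume "g \<in> H"
    then have "inv g \<in> H" "g \<otimes> inv g = \<one>" using assms subgroup.m_inv_closed by auto
    then show "\<one> \<in> g <# H" unfolding l_coset_def by force
  qed
qed

lemma l_coset_eq_imp_subgroup_eq:
  assumes "subgroup A G" "subgroup B G" "g \<in> carrier G" "h \<in> carrier G" "g <# A = h <# B"
  shows "A = B"
proof -
  have eq: "g <# A = g <# B"
    using assms l_repr_independence [of g h B] lcos_self [of g A] by simp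
  have "X = (\<lambda>y. inv g \<otimes> y) ` (g <# X)" if "subgroup X G" for X
    using subgroup.mem_carrier [OF that] assms(3) by (force simp: l_coset_def simp flip: m_assoc)
  then show ?thesis using eq assms(1,2) by metis
qed

text \<open>Write \<open>inv x \<otimes> a = i \<otimes> m\<close>; then
  \<open>x \<otimes> i = a \<otimes> inv m\<close>. Moving \<open>x\<close> by \<open>i\<close> does
  not leave a coset of a subgroup containing \<open>I\<close>, so a common point of several cosets
  can be pushed into one more.\<close>

lemma exists_coset_meet:
  assumes "I <#> M = carrier G" "I \<subseteq> carrier G" "subgroup M G" "x \<in> carrier G" "a \<in> carrier G"
  shows "\<exists>i\<in>I. x \<otimes> i \<in> a <# M"
proof -
  have "inv x \<otimes> a \<in> I <#> M" using assms by simp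
  then obtain i m where im: "i \<in> I" "m \<in> M" "inv x \<otimes> a = i \<otimes> m"
    unfolding set_mult_def by blast
  have car: "i \<in> carrier G" "m \<in> carrier G"
    using im assms(2) subgroup.mem_carrier [OF assms(3)] by auto
  have "a = x \<otimes> (inv x \<otimes> a)" using assms by (simp flip: m_assoc)
  also have "\<dots> = x \<otimes> i \<otimes> m" using im(3) car assms by (simp add: m_assoc)
  finally have "x \<otimes> i = a \<otimes> inv m" using car assms by (simp add: inv_solve_right)
  then show ?thesis
    using im(1) subgroup.m_inv_closed [OF assms(3) im(2)] by (auto simp: l_coset_def)
qed

lemma maximal_elements_subset: "M \<in> maximal_elements \<K> \<Longrightarrow> M \<in> \<K>"
  by (simp add: maximal_elements_def)

theorem contractible_coset_nerve:
  assumes inf: "infinite (maximal_elements (proper_normal_fi G))"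
  shows "contractible_nonempty (geometric_realization (coset_nerve G (proper_normal_fi G)))"
proof (rule contractible_geometric_realization_if_cones)
  let ?\<K> = "proper_normal_fi G"
  show "finite \<sigma>" if "\<sigma> \<in> coset_nerve G ?\<K>" for \<sigma>
    using that by (simp add: coset_nerve_def)
  show "\<tau> \<in> coset_nerve G ?\<K>" if "\<sigma> \<in> coset_nerve G ?\<K>" "\<tau> \<subseteq> \<sigma>" "\<tau> \<noteq> {}" for \<sigma> \<tau>
    using coset_nerve_subset_closed that by blast
  fix B assume B: "finite B" "B \<subseteq> \<Union>(coset_nerve G ?\<K>)"
  then have "\<forall>C\<in>B. \<exists>g H. C = g <# H \<and> g \<in> carrier G \<and> H \<in> ?\<K>"
    unfolding coset_nerve_def left_cosets_def by blast
  then obtain g H where gH: "\<And>C. C \<in> B \<Longrightarrow> C = g C <# H C \<and> g C \<in> carrier G \<and> H C \<in> ?\<K>"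
    by metis
  \<comment> \<open>Right multiplication by an element of \<open>I\<close> preserves every coset in
    \<open>B\<close>.\<close>
  define I where "I = carrier G \<inter> \<Inter>(H ` B)"
  have I: "I \<lhd> G" "finite_index G I"
    unfolding I_def using normal_fi_Inter [of "H ` B"] B(1) gH proper_normal_fiD(1,4) by auto
  have "infinite {M \<in> maximal_elements ?\<K>. \<not> I \<subseteq> M}"
    using infinite_maximal_not_above [OF inf normal_imp_subgroup [OF I(1)] I(2)] .
  then obtain M where M: "M \<in> maximal_elements ?\<K>" "\<not> I \<subseteq> M"
    using infinite_imp_nonempty by blast
  note M\<K> = maximal_elements_subset [OF M(1)]
  have IM: "I <#> M = carrier G" by (rule maximal_set_mult_carrier [OF M(1) I(1) M(2)])
  show "\<exists>w. \<forall>\<rho>\<subseteq>B. \<rho> \<in> coset_nerve G ?\<K> \<or> \<rho> = {} \<longrightarrow> insert w \<rho> \<in> coset_nerve G ?\<K>"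
  proof (intro exI allI impI)
    fix \<rho> assume \<rho>: "\<rho> \<subseteq> B" "\<rho> \<in> coset_nerve G ?\<K> \<or> \<rho> = {}"
    have car: "C \<subseteq> carrier G" if "C \<in> \<rho>" for C
      using gH [of C] \<rho>(1) that l_coset_subset_G proper_normal_fiD(6) by (metis subsetD)
    obtain x where x: "x \<in> carrier G" "\<And>C. C \<in> \<rho> \<Longrightarrow> x \<in> C"
    proof (cases "\<rho> = {}")
      case False
      then obtain y where "\<And>C. C \<in> \<rho> \<Longrightarrow> y \<in> C"
        using \<rho>(2) unfolding coset_nerve_iff by blast
      then show thesis using that car False by blast
    qed auto
    obtain i where i: "i \<in> I" "x \<otimes> i \<in> \<one> <# M"
      using exists_coset_meet [OF IM _ proper_normal_fiD(2) [OF M\<K>] x(1) one_closed]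
      unfolding I_def by blast
    have "x \<otimes> i \<in> C" if "C \<in> \<rho>" for C
    proof -
      have C: "C = g C <# H C" "g C \<in> carrier G" "H C \<in> ?\<K>" "C \<in> B"
        using gH \<rho>(1) that by auto
      moreover have "i \<in> H C" using i(1) C(4) by (simp add: I_def)
      ultimately show ?thesis
        using l_coset_mult_closed [of "H C" "g C" x i] x(2) [OF that] proper_normal_fiD(2) by simp
    qed
    moreover have M1: "\<one> <# M = M"
      using lcos_mult_one proper_normal_fiD(6) [OF M\<K>] by blast
    moreover have "M \<in> left_cosets G ?\<K>"
      unfolding left_cosets_def using M\<K> M1 one_closed by blast
    moreover have "\<rho> \<subseteq> left_cosets G ?\<K>" "finite \<rho>"
      using \<rho>(2) by (auto simp: coset_nerve_def)
    ultimately show "insert M \<rho> \<in> coset_nerve G ?\<K>"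
      using i(2) unfolding coset_nerve_iff by auto
  qed
qed

section \<open>Finitely many maximal elements\<close>

text \<open>A new member is appended if it cuts down the intersection obtained so far and dropped if
  it contains it.\<close>

lemma exists_irredundant_enumeration:
  fixes \<M> :: "'a set set"
  assumes "finite \<M>"
  shows "\<exists>(k :: nat) M. (\<forall>i<k. M i \<in> \<M> \<and> \<not> carrier G \<inter> (\<Inter>j<i. M j) \<subseteq> M i) \<and>
    carrier G \<inter> (\<Inter>j<k. M j) = carrier G \<inter> \<Inter>\<M>"
  using assms
proof induction
  case empty
  show ?case by (rule exI [of _ 0]) simp
next
  case (insert A \<M>)
  from insert.IH obtain k :: nat and M where
    M: "\<forall>i<k. M i \<in> \<M> \<and> \<not> carrier G \<inter> (\<Inter>j<i. M j) \<subseteq> M i"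
      "carrier G \<inter> (\<Inter>j<k. M j) = carrier G \<inter> \<Inter>\<M>"
    by (elim exE conjE)
  show ?case
  proof (cases "carrier G \<inter> (\<Inter>j<k. M j) \<subseteq> A")
    case True
    then have "carrier G \<inter> (\<Inter>j<k. M j) = carrier G \<inter> \<Inter>(insert A \<M>)"
      using M(2) by auto
    then show ?thesis using M(1) by (intro exI [of _ k] exI [of _ M]) simp
  next
    case False
    let ?M = "M(k := A)"
    have eq: "(\<Inter>j<i. ?M j) = (\<Inter>j<i. M j)" if "i \<le> k" for i
      using that by auto
    have "?M i \<in> insert A \<M> \<and> \<not> carrier G \<inter> (\<Inter>j<i. ?M j) \<subseteq> ?M i" if "i < Suc k" for i
      using that M(1) False eq [of i] by (cases "i = k") auto
    moreover have "carrier G \<inter> (\<Inter>j<Suc k. ?M j) = carrier G \<inter> \<Inter>(insert A \<M>)"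
      using M(2) eq [of k] by (auto simp: lessThan_Suc)
    ultimately show ?thesis by blast
  qed
qed

lemma normal_Inter:
  assumes "\<And>M. M \<in> \<M> \<Longrightarrow> M \<lhd> G"
  shows "carrier G \<inter> \<Inter>\<M> \<lhd> G"
  unfolding normal_inv_iff
proof (intro conjI ballI)
  have "subgroup (\<Inter>(insert (carrier G) \<M>)) G"
    using assms normal_imp_subgroup by (intro subgroups_Inter) (auto simp: subgroup_self)
  then show "subgroup (carrier G \<inter> \<Inter>\<M>) G" by simp
  fix g h assume "g \<in> carrier G" "h \<in> carrier G \<inter> \<Inter>\<M>"
  then show "g \<otimes> h \<otimes> inv g \<in> carrier G \<inter> \<Inter>\<M>"
    using normal.inv_op_closed2 [OF assms] by auto
qed

end

section \<open>Inequalities for the level values\<close>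

text \<open>By \<open>eq\<close> the values \<open>s i\<close> are proportional to
  \<open>(k, \<dots>, 1)\<close>, so all differences equal \<open>m\<close> and
  \<open>s 0 = k * m\<close>. Then the left side of \<open>eq\<close> vanishes, and so do
  \<open>s\<close> and \<open>m\<close>. Geometrically, the two terms of \<open>q\<close> could
  cancel only at the barycenter, where just one of them is present.\<close>

lemma descending_proportional_False:
  fixes s :: "nat \<Rightarrow> real"
  assumes k: "0 < k" and m: "m = Min ((\<lambda>i. s i - s (Suc i)) ` {..<k})" "0 < m" and "s k = 0" "0 < \<kappa>"
    and eq: "\<And>i. i < k \<Longrightarrow> (s 0 - k * m) * (real k - real i) = \<kappa> * s i"
  shows False
proof -
  define l where "l = (s 0 - k * m) / \<kappa>"
  have s: "s i = l * (real k - real i)" if "i \<le> k" for i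
    using that eq [of i] assms(4,5) by (cases "i = k") (auto simp: l_def field_simps)
  have "(\<lambda>i. s i - s (Suc i)) ` {..<k} = {l}"
  proof -
    have "s i - s (Suc i) = l" if "i < k" for i
      using that s [of i] s [of "Suc i"] by (simp add: algebra_simps)
    then have "(\<lambda>i. s i - s (Suc i)) ` {..<k} = (\<lambda>i. l) ` {..<k}"
      by (intro image_cong) simp_all
    then show ?thesis using k by (simp add: image_constant_conv lessThan_empty_iff)
  qed
  then have "m = l" by (simp add: m)
  moreover have "s 0 = l * k" using s [of 0] by simp
  ultimately have "s 0 - k * m = 0" by simp
  then have "l = 0" unfolding l_def by simp
  then show False using \<open>m = l\<close> m(2) by linarith
qed

text \<open>Meant for \<open>s i = level i (e c)\<close>: \<open>a\<close>, \<open>b\<close> and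
  \<open>att\<close> say that \<open>s i\<close> is the maximum of 0, the \<open>c j\<close> with
  \<open>i \<le> j\<close>, and all \<open>- c j\<close>. If \<open>m = 0\<close>, then
  \<open>eq\<close> makes \<open>c\<close> a positive multiple of \<open>(k, \<dots>, 1)\<close>;
  hence \<open>s\<close> agrees with \<open>c\<close> and has positive constant differences,
  contradicting \<open>m = 0\<close>. If \<open>m > 0\<close>, then \<open>c = s\<close>, and again
  \<open>s\<close> is proportional to \<open>(k, \<dots>, 1)\<close>.\<close>

lemma cross_polytope_False:
  fixes s c :: "nat \<Rightarrow> real"
  assumes k: "0 < k" and s0: "0 < s 0" and dec: "\<And>i. i < k \<Longrightarrow> s (Suc i) \<le> s i"
    and nn: "\<And>i. i \<le> k \<Longrightarrow> 0 \<le> s i"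
    and m: "m = Min ((\<lambda>i. s i - s (Suc i)) ` {..<k})" and sk: "0 < m \<Longrightarrow> s k = 0"
    and a: "\<And>i j. i \<le> j \<Longrightarrow> j < k \<Longrightarrow> c j \<le> s i" and b: "\<And>i j. i \<le> k \<Longrightarrow> j < k \<Longrightarrow> - c j \<le> s i"
    and att: "\<And>i. i \<le> k \<Longrightarrow> s i = 0 \<or> (\<exists>j. i \<le> j \<and> j < k \<and> s i = c j) \<or> (\<exists>j<k. s i = - c j)"
    and \<mu>: "0 \<le> \<mu>" and eq: "\<And>i. i < k \<Longrightarrow> (s 0 - k * m) * (real k - real i) - m * s i = \<mu> * c i"
  shows False
proof -
  have mle: "m \<le> s i - s (Suc i)" if "i < k" for i
    unfolding m using that by (intro Min_le finite_imageI imageI) simp_all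
  have "m \<in> (\<lambda>i. s i - s (Suc i)) ` {..<k}"
    unfolding m using k by (intro Min_in) (simp_all add: lessThan_empty_iff)
  then have m0: "0 \<le> m" using dec by fastforce
  show False
  proof (cases "m = 0")
    case True
    then have eq': "s 0 * (real k - real i) = \<mu> * c i" if "i < k" for i
      using eq [OF that] by simp
    have "\<mu> \<noteq> 0" using eq' [OF k] s0 k by auto
    then have \<mu>': "0 < \<mu>" using \<mu> by simp
    have c: "c i = s 0 / \<mu> * (real k - real i)" if "i < k" for i
      using eq' [OF that] \<mu>' by (simp add: field_simps)
    have cpos: "0 < c i" if "i < k" for i
      using that s0 \<mu>' by (simp add: c)
    have cdec: "c j \<le> c i" if "i \<le> j" "j < k" for i j
      using that s0 \<mu>' by (simp add: c divide_right_mono mult_left_mono)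
    have s: "s i = s 0 / \<mu> * (real k - real i)" if "i \<le> k" for i
    proof (cases "i = k")
      case True
      then show ?thesis
        using att [of k] nn [of k] cpos by (force simp: not_less)
    next
      case False
      then have i: "i < k" using that by simp
      have "s i = c i"
        using att [OF that]
      proof (elim disjE exE conjE)
        fix j assume "i \<le> j" "j < k" "s i = c j"
        then show ?thesis using a [OF order_refl i] cdec [of i j] by simp
      next
        fix j assume "j < k" "s i = - c j"
        then show ?thesis using nn [OF that] cpos [of j] by simp
      qed (use a [OF order_refl i] cpos [OF i] in simp)
      then show ?thesis using c [OF i] by simp
    qed
    have "(\<lambda>i. s i - s (Suc i)) ` {..<k} = {s 0 / \<mu>}"
    proof -
      have "s i - s (Suc i) = s 0 / \<mu>" if "i < k" for i
        using that \<mu>' s [of i] s [of "Suc i"] by (simp add: field_simps)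
      then have "(\<lambda>i. s i - s (Suc i)) ` {..<k} = (\<lambda>i. s 0 / \<mu>) ` {..<k}"
        by (intro image_cong) simp_all
      then show ?thesis using k by (simp add: image_constant_conv lessThan_empty_iff)
    qed
    then have "m = s 0 / \<mu>" by (simp add: m)
    then show False using True s0 \<mu>' by simp
  next
    case False
    then have mp: "0 < m" using m0 by simp
    \<comment> \<open>The value \<open>s i\<close> is positive. It is not some \<open>- c j\<close>,
      since these are at most \<open>s k = 0\<close>, nor a \<open>c j\<close> with
      \<open>j > i\<close>, since these are at most \<open>s (Suc i) < s i\<close>.\<close>
    have c: "c i = s i" if i: "i < k" for i
    proof -
      have "s (Suc i) < s i" "0 \<le> s (Suc i)" using mle [OF i] mp nn [of "Suc i"] i by auto
      moreover have "s i \<noteq> - c j" if "j < k" for j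
        using b [of k j] sk [OF mp] that calculation by auto
      moreover have "c j \<le> s (Suc i)" if "i < j" "j < k" for j
        using a [of "Suc i" j] that by simp
      ultimately show ?thesis using att [of i] i by (metis le_less less_le_not_le not_less)
    qed
    show False
      by (rule descending_proportional_False [OF k m mp sk [OF mp], of "m + \<mu>"])
        (use eq mp \<mu> c in \<open>auto simp: algebra_simps\<close>)
  qed
qed

section \<open>The flag of normal subgroups and its level functions\<close>

locale maximal_chain = group G for G (structure) +
  fixes M :: "nat \<Rightarrow> 'a set" and k :: nat
  assumes maximal: "i < k \<Longrightarrow> M i \<in> maximal_elements (proper_normal_fi G)"
    and irredundant: "i < k \<Longrightarrow> \<not> carrier G \<inter> (\<Inter>j<i. M j) \<subseteq> M i"
    and below_maximal: "A \<in> maximal_elements (proper_normal_fi G) \<Longrightarrow> carrier G \<inter> (\<Inter>j<k. M j) \<subseteq> A"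
    and k_pos: "0 < k"
begin

definition F :: "nat \<Rightarrow> 'a set" where
  "F i = carrier G \<inter> (\<Inter>j<i. M j)"

abbreviation \<K> :: "'a set set" where
  "\<K> \<equiv> proper_normal_fi G"

lemma M: "i < k \<Longrightarrow> M i \<in> \<K>"
  using maximal maximal_elements_subset by blast

lemma F_0: "F 0 = carrier G"
  by (simp add: F_def)

lemma F_Suc: "F (Suc i) = F i \<inter> M i"
  by (auto simp: F_def lessThan_Suc)

lemma F_antimono: "i \<le> j \<Longrightarrow> F j \<subseteq> F i"
  by (auto simp: F_def)

lemma F_subset_M: "i < j \<Longrightarrow> F j \<subseteq> M i"
  by (auto simp: F_def)

lemma F_not_subset: "i < k \<Longrightarrow> \<not> F i \<subseteq> M i"
  using irredundant by (simp add: F_def)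

lemma F_subset_maximal: "A \<in> maximal_elements \<K> \<Longrightarrow> F k \<subseteq> A"
  using below_maximal by (simp add: F_def)

lemma F_normal:
  assumes "i \<le> k"
  shows "F i \<lhd> G"
  unfolding F_def using assms M proper_normal_fiD(1) by (intro normal_Inter) auto

lemma F_subgroup: "i \<le> k \<Longrightarrow> subgroup (F i) G"
  using F_normal normal_imp_subgroup by blast

text \<open>There is no intermediate subgroup because \<open>F i / F (Suc i) \<cong> G / M i\<close> is simple.\<close>

lemma no_intermediate:
  assumes i: "i < k" and W: "W \<lhd> G" "F (Suc i) \<subseteq> W" "W \<subseteq> F i"
  shows "W = F i \<or> W = F (Suc i)"
proof (cases "W \<subseteq> M i")
  case True
  then show ?thesis using W by (auto simp: F_Suc)
next
  case False
  have WM: "W <#> M i = carrier G" by (rule maximal_set_mult_carrier [OF maximal [OF i] W(1) False])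
  have Fs: "subgroup (F i) G" using i by (intro F_subgroup) simp
  have "f \<in> W" if f: "f \<in> F i" for f
  proof -
    have fG: "f \<in> carrier G" using f by (simp add: F_def)
    \<comment> \<open>The modular law: the factor \<open>m = inv w \<otimes> f\<close> lies in both
      \<open>F i\<close> and \<open>M i\<close>, hence in \<open>F (Suc i)\<close>, which is
      contained in \<open>W\<close>.\<close>
    then obtain w m where wm: "w \<in> W" "m \<in> M i" "f = w \<otimes> m"
      using WM unfolding set_mult_def by blast
    have car: "w \<in> carrier G" "m \<in> carrier G"
      using wm(1,2) W(3) proper_normal_fiD(6) [OF M [OF i]] by (auto simp: F_def)
    then have "m = inv w \<otimes> f" using wm(3) by (simp flip: m_assoc)
    moreover have "inv w \<in> F i" using subgroup.m_inv_closed [OF Fs] wm(1) W(3) by blast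
    ultimately have "m \<in> F i" using subgroup.m_closed [OF Fs] f by simp
    then have "m \<in> W" using wm(2) W(2) by (auto simp: F_Suc)
    then show ?thesis using subgroup.m_closed [OF normal_imp_subgroup [OF W(1)]] wm by simp
  qed
  then show ?thesis using W(3) by blast
qed

text \<open>If \<open>C\<close> is a coset of \<open>H\<close>, some maximal \<open>A\<close>
  contains \<open>H\<close>, and it contains \<open>F k\<close> as well; so \<open>H <#> F k\<close>
  is still proper. Thus \<open>C\<close> is enlarged to a proper coset of a normal subgroup above
  the bottom of the flag.\<close>

lemma coset_set_mult:
  assumes "C \<in> left_cosets G \<K>"
  obtains g L where "g \<in> carrier G" "L \<lhd> G" "L \<noteq> carrier G" "C <#> F k = g <# L" "C \<subseteq> g <# L"
proof -
  obtain g H where C: "C = g <# H" "g \<in> carrier G" "H \<in> \<K>"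
    using assms by (auto simp: left_cosets_def)
  have Fk: "F k \<lhd> G" "subgroup (F k) G" using F_normal F_subgroup by auto
  obtain A where A: "A \<in> maximal_elements \<K>" "H \<subseteq> A"
    using exists_maximal_above [OF C(3)] by blast
  note A\<K> = maximal_elements_subset [OF A(1)]
  have "H <#> F k \<subseteq> A <#> A" using A(2) F_subset_maximal [OF A(1)] by (rule mono_set_mult)
  also have "\<dots> = A" by (rule subgroup_mult_id [OF proper_normal_fiD(2) [OF A\<K>]])
  finally have "H <#> F k \<noteq> carrier G" using proper_normal_fiD(3,6) [OF A\<K>] by blast
  moreover have "H <#> F k \<lhd> G" by (rule normal_set_mult [OF proper_normal_fiD(1) [OF C(3)] Fk(1)])
  moreover have "C <#> F k = g <# (H <#> F k)"
    unfolding C(1) by (rule setmult_lcos_assoc [OF proper_normal_fiD(6) [OF C(3)] subgroup.subset [OF Fk(2)] C(2)])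
  moreover have "C \<subseteq> g <# (H <#> F k)"
    using subset_set_mult(1) [OF proper_normal_fiD(2) [OF C(3)] Fk(2)] unfolding C(1) l_coset_def by blast
  ultimately show thesis using that C(2) by blast
qed

lemma coset_set_mult_proper:
  assumes "C \<in> left_cosets G \<K>"
  shows "\<not> carrier G \<subseteq> C <#> F k"
proof
  assume sub: "carrier G \<subseteq> C <#> F k"
  obtain g L where gL: "g \<in> carrier G" "L \<lhd> G" "L \<noteq> carrier G" "C <#> F k = g <# L"
    using coset_set_mult [OF assms] by metis
  have L: "subgroup L G" using gL(2) by (rule normal_imp_subgroup)
  have "\<one> \<in> g <# L" using sub gL(4) by auto
  then have "g <# L = L" by (rule l_coset_one_mem_iff(2) [OF L gL(1)])
  then show False using sub gL(3,4) subgroup.subset [OF L] by auto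
qed

lemma coset_set_mult_normal:
  assumes "C \<in> left_cosets G \<K>" "\<one> \<in> C <#> F k"
  shows "C <#> F k \<lhd> G"
proof -
  obtain g L where gL: "g \<in> carrier G" "L \<lhd> G" "C <#> F k = g <# L"
    using coset_set_mult [OF assms(1)] by metis
  then show ?thesis
    using l_coset_one_mem_iff(2) [OF normal_imp_subgroup [OF gL(2)] gL(1)] assms(2) by simp
qed

lemma coset_subset: "C \<in> left_cosets G \<K> \<Longrightarrow> C \<subseteq> carrier G"
  using l_coset_subset_G proper_normal_fiD(6) by (auto simp: left_cosets_def)

lemma F_subset_coset_set_mult:
  assumes "x \<in> C" "x \<in> F k"
  shows "F k \<subseteq> C <#> F k"
proof
  fix n assume n: "n \<in> F k"
  have Fk: "subgroup (F k) G" by (simp add: F_subgroup)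
  have "inv x \<otimes> n \<in> F k"
    using subgroup.m_closed [OF Fk] subgroup.m_inv_closed [OF Fk] assms(2) n by blast
  moreover have "n = x \<otimes> (inv x \<otimes> n)"
    using subgroup.mem_carrier [OF Fk] assms(2) n by (simp flip: m_assoc)
  ultimately show "n \<in> C <#> F k" using assms(1) unfolding set_mult_def by blast
qed

lemma subset_coset_set_mult:
  assumes "C \<in> left_cosets G \<K>"
  shows "C \<subseteq> C <#> F k"
proof
  fix x assume x: "x \<in> C"
  have "\<one> \<in> F k" using subgroup.one_closed [OF F_subgroup [OF order_refl]] .
  then have "x \<otimes> \<one> \<in> C <#> F k" using x unfolding set_mult_def by blast
  moreover have "x \<in> carrier G" using x coset_subset [OF assms] by blast
  ultimately show "x \<in> C <#> F k" by simp
qed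

text \<open>If \<open>W r\<close> is the intersection of all \<open>C <#> F k\<close> with \<open>t C > r\<close>, then \<open>level i t\<close> is the least
  \<open>r \<ge> 0\<close> with \<open>F i \<subseteq> W r\<close>.\<close>

definition level :: "nat \<Rightarrow> ('a set \<Rightarrow> real) \<Rightarrow> real" where
  "level i t = sup_on {C. \<not> F i \<subseteq> C <#> F k} t"

text \<open>When \<open>level k t = 0\<close>, the differences of consecutive levels are the
  unnormalized barycentric weights of \<open>t\<close> in the simplex of the flag;
  \<open>gap\<close> is the least of them.\<close>

definition gap :: "('a set \<Rightarrow> real) \<Rightarrow> real" where
  "gap t = Min ((\<lambda>i. level i t - level (Suc i) t) ` {..<k})"

text \<open>In the simplex of the flag \<open>F k \<subset> \<dots> \<subset> F 1\<close> the point \<open>t\<close> has the cross-polytope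
  coordinates \<open>level i t\<close>, and its barycenter is proportional to \<open>(k, \<dots>, 1)\<close>. So \<open>q\<close> points away from
  \<open>t\<close> at the barycenter and, \<open>gap\<close> being zero, towards the barycenter outside of the simplex.\<close>

definition q :: "('a set \<Rightarrow> real) \<Rightarrow> nat \<Rightarrow> real" where
  "q t i = (level 0 t - k * gap t) * (real k - real i) - gap t * level i t"

context
  fixes t \<sigma>
  assumes \<sigma>: "\<sigma> \<in> coset_nerve G \<K>" and t: "t \<in> closed_simplex \<sigma>"
begin

lemma \<sigma>_facts: "finite \<sigma>" "\<sigma> \<subseteq> left_cosets G \<K>"
  using \<sigma> by (auto simp: coset_nerve_def)

lemma level_nonneg: "0 \<le> level i t"
  unfolding level_def by (rule sup_on_bounds(4) [OF \<sigma>_facts(1)]) (rule closed_simplexD(2) [OF t])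

lemma le_level: "\<not> F i \<subseteq> C <#> F k \<Longrightarrow> t C \<le> level i t"
  unfolding level_def by (rule sup_on_bounds(5) [OF \<sigma>_facts(1)]) (auto intro: closed_simplexD(2) [OF t])

lemma level_attained: "level i t = 0 \<or> (\<exists>C. \<not> F i \<subseteq> C <#> F k \<and> level i t = t C)"
proof -
  have "t C = 0" if "C \<notin> \<sigma>" for C using t that by (rule closed_simplexD(2))
  then show ?thesis
    unfolding level_def using sup_on_bounds(3) [OF \<sigma>_facts(1), of t "{C. \<not> F i \<subseteq> C <#> F k}"] by simp
qed

lemma level_Suc_le: "level (Suc i) t \<le> level i t"
  using level_attained [of "Suc i"] le_level [of i] level_nonneg [of i] F_antimono [of i "Suc i"] by fastforce

lemma pos_imp_in_\<sigma>: "0 < t C \<Longrightarrow> C \<in> \<sigma>"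
  using closed_simplexD(2) [OF t, of C] by force

lemma level_0_pos: "0 < level 0 t"
proof -
  obtain C where C: "C \<in> \<sigma>" "t C \<noteq> 0"
    using closed_simplexD(3) [OF t] by (metis sum.neutral zero_neq_one)
  then have "0 < t C" using closed_simplexD(1) [OF t, of C] by simp
  also have "\<dots> \<le> level 0 t"
    using C(1) \<sigma>_facts(2) coset_set_mult_proper [of C] by (intro le_level) (auto simp: F_0)
  finally show ?thesis .
qed

text \<open>Strict decrease forces the intersection of all enlarged cosets of weight above
  \<open>level i t\<close> to be exactly \<open>F i\<close>, by induction down the flag, which
  cannot be refined. At \<open>i = k\<close> a common point of the simplex therefore lies in
  \<open>F k\<close>, so every \<open>C \<in> \<sigma>\<close> meets \<open>F k\<close>, and no
  coset is left to attain a positive \<open>level k t\<close>.\<close>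

lemma level_k_eq_0:
  assumes dec: "\<And>i. i < k \<Longrightarrow> level (Suc i) t < level i t"
  shows "level k t = 0"
proof (rule ccontr)
  assume "level k t \<noteq> 0"
  define V where "V i = {C. level i t < t C}" for i
  define W where "W i = carrier G \<inter> \<Inter>((\<lambda>C. C <#> F k) ` V i)" for i
  have V: "V i \<subseteq> \<sigma>" for i
    using level_nonneg [of i] pos_imp_in_\<sigma> unfolding V_def by fastforce
  have FV: "F i \<subseteq> C <#> F k" if "C \<in> V i" for i C
    using that le_level [of i C] unfolding V_def by fastforce
  have FW: "F i \<subseteq> W i" for i
    using FV unfolding W_def by (auto simp: F_def)
  have W: "W i = F i" if "i \<le> k" for i
    using that
  proof (induction i)
    case 0
    then show ?case using FW [of 0] by (auto simp: W_def F_0)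
  next
    case (Suc i)
    then have i: "i < k" by simp
    have "V i \<subseteq> V (Suc i)" using dec [OF i] by (auto simp: V_def)
    then have "W (Suc i) \<subseteq> W i" by (auto simp: W_def)
    then have sub: "W (Suc i) \<subseteq> F i" using Suc by simp
    have "W (Suc i) \<lhd> G"
      unfolding W_def
    proof (rule normal_Inter)
      fix X assume "X \<in> (\<lambda>C. C <#> F k) ` V (Suc i)"
      then obtain C where C: "C \<in> V (Suc i)" "X = C <#> F k" by blast
      \<comment> \<open>An enlarged coset containing the identity is a normal subgroup, so
        \<open>no_intermediate\<close> becomes applicable.\<close>
      have "\<one> \<in> F (Suc i)" using subgroup.one_closed [OF F_subgroup [OF Suc.prems]] .
      then have "\<one> \<in> C <#> F k" using FV [OF C(1)] by blast
      then show "X \<lhd> G" using coset_set_mult_normal [of C] C V \<sigma>_facts(2) by blast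
    qed
    then have "W (Suc i) = F i \<or> W (Suc i) = F (Suc i)"
      by (rule no_intermediate [OF i _ FW sub])
    moreover have "W (Suc i) \<noteq> F i"
    \<comment> \<open>A coset attaining \<open>level i t\<close> has weight above
      \<open>level (Suc i) t\<close>, so it takes part in the intersection \<open>W (Suc i)\<close>,
      yet it does not contain \<open>F i\<close>.\<close>
    proof -
      have "level i t \<noteq> 0" using dec [OF i] level_nonneg [of "Suc i"] by simp
      then obtain C where C: "\<not> F i \<subseteq> C <#> F k" "level i t = t C"
        using level_attained [of i] by blast
      then have "C \<in> V (Suc i)" using dec [OF i] by (simp add: V_def)
      then have "W (Suc i) \<subseteq> C <#> F k" by (auto simp: W_def)
      then show ?thesis using C(1) by blast
    qed
    ultimately show ?case by blast
  qed
  obtain C where C: "\<not> F k \<subseteq> C <#> F k" "level k t = t C"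
    using level_attained [of k] \<open>level k t \<noteq> 0\<close> by blast
  then have "C \<in> \<sigma>" using \<open>level k t \<noteq> 0\<close> level_nonneg [of k] by (intro pos_imp_in_\<sigma>) simp
  obtain x where x: "\<And>D. D \<in> \<sigma> \<Longrightarrow> x \<in> D"
    using \<sigma> unfolding coset_nerve_iff by blast
  have "x \<in> C" using x \<open>C \<in> \<sigma>\<close> .
  moreover have "x \<in> W k"
  proof -
    have "x \<in> carrier G" using \<open>x \<in> C\<close> \<open>C \<in> \<sigma>\<close> \<sigma>_facts(2) coset_subset by blast
    moreover have "x \<in> D <#> F k" if "D \<in> V k" for D
      using x [of D] that V \<sigma>_facts(2) subset_coset_set_mult [of D] by blast
    ultimately show ?thesis by (auto simp: W_def)
  qed
  ultimately have "F k \<subseteq> C <#> F k"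
    using W [OF order_refl] by (intro F_subset_coset_set_mult) auto
  then show False using C(1) by blast
qed

lemma gap_le: "i < k \<Longrightarrow> gap t \<le> level i t - level (Suc i) t"
  unfolding gap_def by (intro Min_le finite_imageI imageI) simp_all

lemma level_k_eq_0_if_gap: "0 < gap t \<Longrightarrow> level k t = 0"
  using gap_le by (intro level_k_eq_0) fastforce

text \<open>For \<open>gap t = 0\<close> the coordinate \<open>q t 0\<close> is
  \<open>k * level 0 t\<close>, which is positive. Otherwise \<open>q t = 0\<close> would make the
  levels proportional to \<open>(k, \<dots>, 1)\<close>.\<close>

lemma q_nonzero: "\<exists>i<k. q t i \<noteq> 0"
proof (rule ccontr)
  assume "\<not> ?thesis"
  then have eq: "(level 0 t - k * gap t) * (real k - real i) = gap t * level i t" if "i < k" for i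
    using that by (simp add: q_def)
  have "gap t \<in> (\<lambda>i. level i t - level (Suc i) t) ` {..<k}"
    unfolding gap_def using k_pos by (intro Min_in) (simp_all add: lessThan_empty_iff)
  then have "0 \<le> gap t" using level_Suc_le by fastforce
  moreover have "gap t \<noteq> 0" using eq [OF k_pos] k_pos level_0_pos by auto
  ultimately have pos: "0 < gap t" by simp
  show False
    by (rule descending_proportional_False [OF k_pos gap_def pos level_k_eq_0_if_gap [OF pos] pos eq])
qed

end

end

section \<open>Continuity of the collapse and the cross-polytope\<close>

context maximal_chain
begin

lemma continuous_map_level:
  "continuous_map (geometric_realization (coset_nerve G \<K>)) euclideanreal (level i)"
  unfolding level_def
  by (rule continuous_map_geometric_realization_sup_on) (simp add: coset_nerve_def)

lemma continuous_map_gap: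
  "continuous_map (geometric_realization (coset_nerve G \<K>)) euclideanreal gap"
proof -
  have "gap t = Min (insert (level 0 t - level (Suc 0) t)
      ((\<lambda>i. level i t - level (Suc i) t) ` {..<k}))" for t
  proof -
    have "level 0 t - level (Suc 0) t \<in> (\<lambda>i. level i t - level (Suc i) t) ` {..<k}"
      using k_pos by (intro imageI) simp
    then show ?thesis by (simp add: gap_def insert_absorb)
  qed
  then have "gap = (\<lambda>t. Min (insert (level 0 t - level (Suc 0) t)
      ((\<lambda>i. level i t - level (Suc i) t) ` {..<k})))" ..
  then show ?thesis
    by (simp only:) (intro continuous_map_Min_insert continuous_map_diff continuous_map_level finite_lessThan)
qed

lemma continuous_map_q:
  "continuous_map (geometric_realization (coset_nerve G \<K>)) euclideanreal (\<lambda>t. q t i)"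
  unfolding q_def by (intro continuous_intros continuous_map_level continuous_map_gap)

text \<open>As in the Chinese remainder theorem: \<open>F j <#> M j\<close> is the whole group, so a
  common point of the first \<open>j\<close> cosets can be moved by an element of \<open>F j\<close>
  into the next one, and \<open>F j\<close> preserves the earlier cosets.\<close>

lemma exists_common_coset_point:
  assumes "\<And>i. i < k \<Longrightarrow> a i \<in> carrier G" "j \<le> k"
  shows "\<exists>x\<in>carrier G. \<forall>i<j. x \<in> a i <# M i"
  using assms(2)
proof (induction j)
  case 0
  then show ?case by auto
next
  case (Suc j)
  then obtain x where x: "x \<in> carrier G" "\<And>i. i < j \<Longrightarrow> x \<in> a i <# M i" by auto
  have j: "j < k" using Suc.prems by simp
  have Mi: "subgroup (M i) G" if "i < k" for i by (rule proper_normal_fiD(2) [OF M [OF that]])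
  have "F j <#> M j = carrier G"
    using j by (intro maximal_set_mult_carrier maximal F_normal F_not_subset) simp_all
  then obtain f where f: "f \<in> F j" "x \<otimes> f \<in> a j <# M j"
    using exists_coset_meet [OF _ _ Mi [OF j] x(1) assms(1) [OF j]] F_def by blast
  have "x \<otimes> f \<in> a i <# M i" if "i < Suc j" for i
  proof (cases "i = j")
    case False
    then have i: "i < j" "i < k" using that j by auto
    have "f \<in> M i" using f(1) F_subset_M [OF i(1)] by blast
    then show ?thesis using l_coset_mult_closed [OF Mi [OF i(2)] assms(1) [OF i(2)] x(2) [OF i(1)]] by blast
  qed (use f in simp)
  moreover have "x \<otimes> f \<in> carrier G" using x(1) f(1) by (simp add: F_def)
  ultimately show ?case by blast
qed

text \<open>The cosets of \<open>M i\<close> and \<open>g i <# M i\<close> with \<open>g i \<in> F i - M i\<close> span the boundary of a cross-polytope.\<close>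

theorem not_contractible_coset_nerve:
  "\<not> contractible_space (geometric_realization (coset_nerve G \<K>))"
proof -
  let ?K = "coset_nerve G \<K>"
  \<comment> \<open>The sphere \<open>nsphere n\<close> has the coordinates
    \<open>0, \<dots>, n\<close>, so \<open>n = k - 1\<close>.\<close>
  obtain n where kn: "k = Suc n" using k_pos gr0_implies_Suc by blast
  have "\<forall>i. \<exists>g. i < k \<longrightarrow> g \<in> F i \<and> g \<notin> M i" using F_not_subset by blast
  then obtain g where g: "\<And>i. i < k \<Longrightarrow> g i \<in> F i \<and> g i \<notin> M i" by metis
  have gG: "g i \<in> carrier G" if "i < k" for i using g [OF that] by (simp add: F_def)
  have Ms: "subgroup (M i) G" if "i < k" for i by (rule proper_normal_fiD(2) [OF M [OF that]])
  define R where "R i = g i <# M i" for i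
  have M1: "M i = \<one> <# M i" if "i < k" for i
    using lcos_mult_one [OF subgroup.subset [OF Ms [OF that]]] by simp
  have inM: "\<one> \<in> M i" if "i < k" for i using subgroup.one_closed [OF Ms [OF that]] .
  have notinR: "\<one> \<notin> R i" if "i < k" for i
    unfolding R_def using l_coset_one_mem_iff(1) [OF Ms [OF that] gG [OF that]] g [OF that] by simp
  have Mne: "M i \<noteq> M j" if "i < j" "j < k" for i j
    using F_subset_M [OF that(1)] F_not_subset [OF that(2)] by metis
  have Minj: "M i = M j \<longleftrightarrow> i = j" if "i < k" "j < k" for i j
    using Mne that by (metis linorder_neqE_nat)
  have Rinj: "R i = R j \<longleftrightarrow> i = j" if "i < k" "j < k" for i j
    using l_coset_eq_imp_subgroup_eq [OF Ms [OF that(1)] Ms [OF that(2)] gG [OF that(1)] gG [OF that(2)]]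
      Minj [OF that] unfolding R_def by blast
  have MR: "M i \<noteq> R j" "R j \<noteq> M i" if "i < k" "j < k" for i j
    using inM notinR that by metis+
  \<comment> \<open>The map \<open>e\<close> is radial projection onto the boundary of the
    cross-polytope: a positive \<open>c i\<close> is put on \<open>M i\<close>, a negative one on
    the opposite vertex \<open>R i\<close>, and the sum of absolute values normalizes.\<close>
  define num where "num c C = (\<Sum>i<k. (if C = M i then max 0 (c i) else 0)
      + (if C = R i then max 0 (- c i) else 0))" for c :: "nat \<Rightarrow> real" and C
  define nu where "nu c = (\<Sum>i<k. \<bar>c i\<bar>)" for c :: "nat \<Rightarrow> real"
  define e where "e c C = num c C / nu c" for c C
  have numM: "num c (M i) = max 0 (c i)" and numR: "num c (R i) = max 0 (- c i)" if "i < k" for c i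
  proof -
    have "num c (M i) = (\<Sum>j<k. if i = j then max 0 (c j) else 0)"
      unfolding num_def by (intro sum.cong refl) (simp add: Minj MR that)
    then show "num c (M i) = max 0 (c i)" using that by simp
    have "num c (R i) = (\<Sum>j<k. if i = j then max 0 (- c j) else 0)"
      unfolding num_def by (intro sum.cong refl) (simp add: Rinj MR that)
    then show "num c (R i) = max 0 (- c i)" using that by simp
  qed
  have num0: "num c C = 0" if "\<And>i. i < k \<Longrightarrow> C \<noteq> M i \<and> C \<noteq> R i" for c C
    using that by (simp add: num_def)
  have nu: "0 < nu c" if "c \<in> topspace (nsphere n)" for c
  proof -
    have "\<exists>i<k. c i \<noteq> 0"
    proof (rule ccontr)
      assume "\<not> ?thesis"
      then have "(\<Sum>i\<le>n. (c i)\<^sup>2) = 0" by (simp add: kn less_Suc_eq_le)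
      then show False using that by (simp add: nsphere)
    qed
    then obtain i where "i < k" "c i \<noteq> 0" by blast
    then show ?thesis unfolding nu_def by (intro sum_pos2 [of _ i]) auto
  qed
  \<comment> \<open>The facet containing \<open>e c\<close>; for \<open>c i = 0\<close> either of
    the two vertices would do.\<close>
  define D where "D c i = (if 0 \<le> c i then M i else R i)" for c :: "nat \<Rightarrow> real" and i
  define V where "V = M ` {..<k} \<union> R ` {..<k}"
  have DK: "D c ` {..<k} \<in> {\<rho> \<in> ?K. \<rho> \<subseteq> V}" for c
  proof -
    let ?a = "\<lambda>i. if 0 \<le> c i then \<one> else g i"
    have Da: "D c i = ?a i <# M i" if "i < k" for i
      using M1 [OF that] by (simp add: D_def R_def)
    have a: "?a i \<in> carrier G" if "i < k" for i using gG [OF that] by simp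
    obtain x where "\<And>i. i < k \<Longrightarrow> x \<in> ?a i <# M i"
      using exists_common_coset_point [of ?a k] a by blast
    then have "\<forall>C\<in>D c ` {..<k}. x \<in> C" using Da by auto
    moreover have "D c i \<in> left_cosets G \<K>" if "i < k" for i
      unfolding Da [OF that] left_cosets_def using a [OF that] M [OF that] by blast
    ultimately have "D c ` {..<k} \<in> ?K"
      unfolding coset_nerve_iff using k_pos by (auto simp: lessThan_empty_iff)
    then show ?thesis by (auto simp: D_def V_def)
  qed
  have eD: "e c \<in> closed_simplex (D c ` {..<k})" if c: "c \<in> topspace (nsphere n)" for c
    unfolding closed_simplex_def
  proof (intro CollectI conjI allI impI)
    have "0 \<le> num c C" for C unfolding num_def by (intro sum_nonneg) auto
    then show "0 \<le> e c C" for C using nu [OF c] by (simp add: e_def)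
    show "e c C = 0" if C: "C \<notin> D c ` {..<k}" for C
    proof (cases "\<exists>i<k. C = M i \<or> C = R i")
      case True
      then obtain i where i: "i < k" "C = M i \<or> C = R i" by blast
      then have "D c i \<noteq> C" using C by auto
      then show ?thesis using i numM [OF i(1)] numR [OF i(1)] by (auto simp: e_def D_def split: if_splits)
    qed (use num0 in \<open>auto simp: e_def\<close>)
    have "inj_on (D c) {..<k}"
      by (intro inj_onI) (auto simp: D_def Minj Rinj MR split: if_splits)
    then have "(\<Sum>C\<in>D c ` {..<k}. e c C) = (\<Sum>i<k. e c (D c i))"
      by (simp add: sum.reindex)
    also have "\<dots> = (\<Sum>i<k. \<bar>c i\<bar> / nu c)"
      using numM numR by (intro sum.cong) (auto simp: e_def D_def)
    also have "\<dots> = 1" using nu [OF c] by (simp add: nu_def flip: sum_divide_distrib)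
    finally show "(\<Sum>C\<in>D c ` {..<k}. e c C) = 1" .
  qed
  have proj: "continuous_map (nsphere n) euclideanreal (\<lambda>c. c i)" for i
    by (rule continuous_map_nsphere_projection)
  have "continuous_map (nsphere n) (geometric_realization ?K) e"
  proof (rule continuous_map_into_geometric_realization)
    show "finite {\<rho> \<in> ?K. \<rho> \<subseteq> V}"
      by (rule finite_subset [of _ "Pow V"]) (auto simp: V_def)
    show "e \<in> topspace (nsphere n) \<rightarrow> (\<Union>\<sigma>\<in>{\<rho> \<in> ?K. \<rho> \<subseteq> V}. closed_simplex \<sigma>)"
      using eD DK by blast
    show "continuous_map (nsphere n) (powertop_real UNIV) e"
      unfolding continuous_map_componentwise_UNIV
    proof
      fix C
      have "continuous_map (nsphere n) euclideanreal (\<lambda>c. if C = M i then max 0 (c i) else 0)"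
        "continuous_map (nsphere n) euclideanreal (\<lambda>c. if C = R i then max 0 (- c i) else 0)" for i
        by (cases "C = M i"; cases "C = R i";
            simp add: continuous_map_real_max proj continuous_map_minus)+
      then show "continuous_map (nsphere n) euclideanreal (\<lambda>c. e c C)"
        unfolding e_def num_def nu_def
        by (intro continuous_map_real_divide continuous_map_sum continuous_map_add continuous_map_real_abs proj)
          (use nu in \<open>auto simp: nu_def less_le\<close>)
    qed
  qed blast
  then show ?thesis
  proof (rule not_contractible_space_if_sphere_map)
    show "continuous_map (geometric_realization ?K) euclideanreal (\<lambda>t. q t i)" for i
      by (rule continuous_map_q)
    show "\<exists>i\<le>n. q t i \<noteq> 0" if "t \<in> topspace (geometric_realization ?K)" for t
      using that q_nonzero kn less_Suc_eq_le unfolding topspace_geometric_realization by blast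
    fix c \<mu> assume c: "c \<in> topspace (nsphere n)" and \<mu>: "0 \<le> (\<mu>::real)"
    note ec = eD [OF c]
    have K: "D c ` {..<k} \<in> ?K" using DK by blast
    show "\<exists>i\<le>n. q (e c) i \<noteq> \<mu> * c i"
    proof (rule ccontr)
      assume neg: "\<not> ?thesis"
      \<comment> \<open>The following facts decide which vertices count for \<open>level i\<close>:
        the \<open>M j\<close> with \<open>i \<le> j\<close>, and every \<open>R j\<close>, because
        \<open>R j <#> F k \<subseteq> R j\<close> misses the identity.\<close>
      have FM: "F k \<subseteq> M j" if "j < k" for j by (rule F_subset_M [OF that])
      have MF: "M j <#> F k \<subseteq> M j" if "j < k" for j
        using mono_set_mult [OF order_refl FM [OF that]] subgroup_mult_id [OF Ms [OF that]] by metis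
      have hitM: "\<not> F i \<subseteq> M j <#> F k" if "i \<le> j" "j < k" for i j
        using MF [OF that(2)] F_not_subset [OF that(2)] F_antimono [OF that(1)] by blast
      have noM: "F i \<subseteq> M j <#> F k" if "j < i" "i \<le> k" for i j
      proof -
        have "j < k" using that by simp
        then have "M j \<subseteq> M j <#> F k" by (intro subset_set_mult(1) Ms F_subgroup order_refl)
        then show ?thesis using F_subset_M [OF that(1)] by blast
      qed
      have hitR: "\<not> F i \<subseteq> R j <#> F k" if "i \<le> k" "j < k" for i j
      proof
        assume sub: "F i \<subseteq> R j <#> F k"
        have "\<one> \<in> F i" using subgroup.one_closed [OF F_subgroup [OF that(1)]] .
        moreover have "R j <#> F k \<subseteq> R j"
        proof
          fix y assume "y \<in> R j <#> F k"
          then obtain x f where "x \<in> R j" "f \<in> F k" "y = x \<otimes> f" unfolding set_mult_def by blast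
          then show "y \<in> R j"
            using l_coset_mult_closed [OF Ms [OF that(2)] gG [OF that(2)]] FM [OF that(2)]
            unfolding R_def by blast
        qed
        ultimately show False using sub notinR [OF that(2)] by blast
      qed
      let ?s = "\<lambda>i. level i (e c)" and ?c = "\<lambda>i. c i / nu c"
      have ecM: "e c (M i) = max 0 (?c i)" and ecR: "e c (R i) = max 0 (- ?c i)" if "i < k" for i
        using numM [OF that] numR [OF that] nu [OF c] by (auto simp: e_def max_def divide_simps)
      show False
      \<comment> \<open>Since \<open>e\<close> divides by \<open>nu c\<close>, the factor
        \<open>\<mu>\<close> is multiplied by it.\<close>
      proof (rule cross_polytope_False [of k ?s "gap (e c)" ?c "\<mu> * nu c"])
        show "0 < k" by (rule k_pos)
        show "0 < ?s 0" by (rule level_0_pos [OF K ec])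
        show "?s (Suc i) \<le> ?s i" for i by (rule level_Suc_le [OF K ec])
        show "0 \<le> ?s i" for i by (rule level_nonneg [OF K ec])
        show "gap (e c) = Min ((\<lambda>i. ?s i - ?s (Suc i)) ` {..<k})" by (rule gap_def)
        show "0 < gap (e c) \<Longrightarrow> ?s k = 0" by (rule level_k_eq_0_if_gap [OF K ec])
        show "?c j \<le> ?s i" if "i \<le> j" "j < k" for i j
          using le_level [OF K ec hitM [OF that]] ecM [OF that(2)] by simp
        show "- ?c j \<le> ?s i" if "i \<le> k" "j < k" for i j
          using le_level [OF K ec hitR [OF that]] ecR [OF that(2)] by simp
        show "?s i = 0 \<or> (\<exists>j. i \<le> j \<and> j < k \<and> ?s i = ?c j) \<or> (\<exists>j<k. ?s i = - ?c j)" if i: "i \<le> k" for i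
        proof (cases "?s i = 0")
          case False
          then obtain C where C: "\<not> F i \<subseteq> C <#> F k" "?s i = e c C"
            using level_attained [OF K ec, of i] by blast
          then have "num c C \<noteq> 0" using False by (auto simp: e_def)
          then obtain j where j: "j < k" "C = M j \<or> C = R j" using num0 by metis
          from j(2) show ?thesis
          proof
            assume CM: "C = M j"
            then have "i \<le> j" using noM [of j i] C(1) i by (meson not_le)
            moreover have "?s i = ?c j" using False C(2) ecM [OF j(1)] CM by (simp add: max_def split: if_splits)
            ultimately show ?thesis using j(1) by blast
          next
            assume CR: "C = R j"
            then have "?s i = - ?c j" using False C(2) ecR [OF j(1)] by (simp add: max_def split: if_splits)
            then show ?thesis using j(1) by blast
          qed
        qed simp
        show "0 \<le> \<mu> * nu c" using \<mu> nu [OF c] by simp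
        show "(?s 0 - k * gap (e c)) * (real k - real i) - gap (e c) * ?s i = \<mu> * nu c * ?c i" if "i < k" for i
        proof -
          have "q (e c) i = \<mu> * c i" using neg that kn by (simp add: less_Suc_eq_le)
          then show ?thesis using nu [OF c] by (simp add: q_def)
        qed
      qed
    qed
  qed
qed

end

section \<open>The equivalences\<close>

theorem (in group) not_contractible_coset_nerve_if_finite:
  assumes "finite (maximal_elements (proper_normal_fi G))"
  shows "\<not> contractible_nonempty (geometric_realization (coset_nerve G (proper_normal_fi G)))"
proof
  let ?X = "maximal_elements (proper_normal_fi G)"
  let ?R = "geometric_realization (coset_nerve G (proper_normal_fi G))"
  assume contr: "contractible_nonempty ?R"
  then have "coset_nerve G (proper_normal_fi G) \<noteq> {}"
    by (auto simp: contractible_nonempty_def topspace_geometric_realization)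
  then have "proper_normal_fi G \<noteq> {}"
    by (auto simp: coset_nerve_def left_cosets_def)
  then obtain A where A: "A \<in> ?X" using exists_maximal_above by blast
  obtain k :: nat and M where M: "\<And>i. i < k \<Longrightarrow> M i \<in> ?X \<and> \<not> carrier G \<inter> (\<Inter>j<i. M j) \<subseteq> M i"
    and eq: "carrier G \<inter> (\<Inter>j<k. M j) = carrier G \<inter> \<Inter>?X"
    using exists_irredundant_enumeration [OF assms] by metis
  have "k \<noteq> 0"
  proof
    assume "k = 0"
    then have "carrier G \<subseteq> A" using eq A by auto
    then show False using proper_normal_fiD(3,6) [OF maximal_elements_subset [OF A]] by blast
  qed
  then interpret maximal_chain G M k
    using M eq by unfold_locales auto
  show False
    using contr not_contractible_coset_nerve by (simp add: contractible_nonempty_def)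
qed

text \<open>If the group has no proper normal subgroup of finite index, \<open>c3\<close> and
  \<open>c4\<close> hold vacuously, whereas the nerve is empty and \<open>c1\<close> and
  \<open>c2\<close> fail. The return from \<open>c4\<close> to \<open>c2\<close> is therefore stated
  for a nonempty family, and \<open>c3 \<longleftrightarrow> c4\<close> separately.\<close>

theorem theorem12:
  fixes G :: "('a, 'b) monoid_scheme"
  assumes "group G"
  shows "let
      c1 = contractible_nonempty (geometric_realization (coset_nerve G (proper_normal_fi G)));
      c2 = infinite (maximal_elements (proper_normal_fi G));
      c3 = (\<forall>H. subgroup H G \<and> H \<noteq> carrier G \<and> finite_index G H \<longrightarrow>
              infinite {M. is_complement G H M \<and> M \<lhd> G \<and> finite_index G M});
      c4 = (\<forall>N\<in>proper_normal_fi G.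
              \<exists>M. is_complement G N M \<and> M \<lhd> G \<and> finite_index G M)
    in (c1 \<longleftrightarrow> c2) \<and> (c2 \<longrightarrow> c3) \<and> (c3 \<longleftrightarrow> c4) \<and>
       (proper_normal_fi G \<noteq> {} \<longrightarrow> c4 \<longrightarrow> c2)"
proof -
  interpret group G by (rule assms)
  let ?X = "maximal_elements (proper_normal_fi G)"
  let ?c1 = "contractible_nonempty (geometric_realization (coset_nerve G (proper_normal_fi G)))"
  let ?c3 = "\<forall>H. subgroup H G \<and> H \<noteq> carrier G \<and> finite_index G H \<longrightarrow>
    infinite {M. is_complement G H M \<and> M \<lhd> G \<and> finite_index G M}"
  let ?c4 = "\<forall>N\<in>proper_normal_fi G. \<exists>M. is_complement G N M \<and> M \<lhd> G \<and> finite_index G M"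
  have 12: "?c1 \<longleftrightarrow> infinite ?X"
    using contractible_coset_nerve not_contractible_coset_nerve_if_finite by blast
  have 23: "infinite ?X \<longrightarrow> ?c3"
    using infinite_complements by blast
  have 34: "?c3 \<longrightarrow> ?c4"
  proof (intro impI ballI)
    fix N assume c3: ?c3 and N: "N \<in> proper_normal_fi G"
    then have "infinite {M. is_complement G N M \<and> M \<lhd> G \<and> finite_index G M}"
      using proper_normal_fiD(2-4) [OF N] by blast
    then show "\<exists>M. is_complement G N M \<and> M \<lhd> G \<and> finite_index G M"
      using infinite_imp_nonempty by blast
  qed
  have 42: "proper_normal_fi G \<noteq> {} \<longrightarrow> ?c4 \<longrightarrow> infinite ?X"
    using infinite_maximal_if_complements by blast
  have 43: "?c4 \<longrightarrow> ?c3"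
  proof (cases "proper_normal_fi G = {}")
    case True
    \<comment> \<open>In the degenerate case the normal core of a finite-index subgroup is the whole
      group, so \<open>c3\<close> is vacuous.\<close>
    have "H = carrier G" if H: "subgroup H G" "finite_index G H" for H
    proof -
      obtain N where "N \<lhd> G" "finite_index G N" "N \<subseteq> H"
        using exists_normal_core [OF H] by blast
      then show ?thesis
        using True subgroup.subset [OF H(1)] unfolding proper_normal_fi_def by blast
    qed
    then show ?thesis by blast
  qed (use 42 23 in blast)
  show ?thesis unfolding Let_def using 12 23 34 42 43 by blast
qed

end
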